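(* Let $m\ge2$, let $H$ be a complex Hilbert space, let $E$ be a POVM on $\Omega_m=\{0,\dots,m-1\}^{\mathbb N}$ with values in $B(H)$, and let $X=\{X_w\}$ be a strictly positive normalized range martingale for $E$. Let $Y=\{Y_w\}$ be a strictly positive normalized range martingale for $E^X$ in the factor space coordinates, and define $$Z_w=X_w^{1/2}Y_wX_w^{1/2}$$ for every finite word $w$. Then $Z=\{Z_w\}$ is a strictly positive normalized range martingale for $E$, and $$(E^X)^Y=E^Z.$$
   Context: $\Omega_m$ carries its product Borel $\sigma$-algebra $\mathcal B(\Omega_m)$. For a finite word $w=w_1\cdots w_n$ in $\{0,\dots,m-1\}$, $[w]=\{x\in\Omega_m:x_1=w_1,\dots,x_n=w_n\}$; the empty word is $\varnothing$, and $[\varnothing]=\Omega_m$; $wj$ is $w$ with the letter $j$ appended. A POVM on $\Omega_m$ with values in $B(H)$ is a map $E:\mathcal B(\Omega_m)\to B(H)_+$ that is countably additive in the weak operator topology and satisfies $E(\Omega_m)=I$. Put $E_w=E([w])$ and $H_w=\overline{\operatorname{ran}}(E_w^{1/2})$; operators on $H_w$ are extended by zero on $H_w^\perp$ in products inside $B(H)$. The edge contraction $C_{wj}:H_w\to H_{wj}$ of $E$ is the unique contraction with $C_{wj}E_w^{1/2}h=E_{wj}^{1/2}h$ for all $h\in H$. A bounded range martingale for $E$ is a family of self-adjoint operators $X_w\in B(H_w)$, indexed by all finite words $w$, such that $\sup_w\|X_w\|<\infty$ and $X_w=\sum_{j=0}^{m-1}C_{wj}^*X_{wj}C_{wj}$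 for every $w$. It is strictly positive if there are constants $0<a\le b<\infty$ with $aI_{H_w}\le X_w\le bI_{H_w}$ for every $w$, and normalized if $X_\varnothing=I_H$. For a strictly positive normalized $X$, $E^X$ denotes the unique POVM on $\Omega_m$ with $E^X([w])=E_w^{1/2}X_wE_w^{1/2}$ for all $w$. Factor space coordinates for $E^X$: put $S^X_w=X_w^{1/2}E_w^{1/2}:H\to H_w$, so that $E^X([w])=(S^X_w)^*S^X_w$ and $S^X_w$ has dense range in $H_w$. In these coordinates the edge contractions of $E^X$ are the unique contractions $C^X_{wj}:H_w\to H_{wj}$ with $C^X_{wj}S^X_wh=S^X_{wj}h$ for $h\in H$; explicitly $C^X_{wj}=X_{wj}^{1/2}C_{wj}X_w^{-1/2}$. A strictly positive normalized range martingale for $E^X$ in these coordinates is a family of self-adjoint $Y_w\in B(H_w)$ with $Y_w=\sum_{j=0}^{m-1}(C^X_{wj})^*Y_{wj}C^X_{wj}$ for every $w$, with $a'I_{H_w}\le Y_w\le b'I_{H_w}$ for all $w$ and some constants $0<a'\le b'<\infty$, and with $Y_\varnothing=I_H$. For such $Y$, $(E^X)^Y$ denotes the unique POVM with cylinder values $(E^X)^Y([w])=(S^X_w)^*Y_wS^X_w$. *)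

theory Defs
  imports "HOL-Analysis.Analysis"
begin

section \<open>Complex Hilbert spaces\<close>

text \<open>The real structure of the type is the restriction of the complex one, so that the library's
  norms, limits and bounded (real-)linear maps apply; the inner product is antilinear in its first
  argument.\<close>

class complex_inner = real_normed_vector +
  fixes scaleC :: "complex \<Rightarrow> 'a \<Rightarrow> 'a"  (infixr \<open>*\<^sub>C\<close> 75)
    and cinner :: "'a \<Rightarrow> 'a \<Rightarrow> complex"
  assumes scaleC_add_right: "c *\<^sub>C (x + y) = c *\<^sub>C x + c *\<^sub>C y"
    and scaleC_add_left: "(c + d) *\<^sub>C x = c *\<^sub>C x + d *\<^sub>C x"
    and scaleC_scaleC: "c *\<^sub>C d *\<^sub>C x = (c * d) *\<^sub>C x"
    and scaleC_of_real: "complex_of_real r *\<^sub>C x = r *\<^sub>R x"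
    and cinner_commute: "cinner x y = cnj (cinner y x)"
    and cinner_add_right: "cinner x (y + z) = cinner x y + cinner x z"
    and cinner_scaleC_right: "cinner x (c *\<^sub>C y) = c * cinner x y"
    and cinner_self: "cinner x x = complex_of_real ((norm x)\<^sup>2)"

class chilbert_space = complex_inner + complete_space

instantiation complex :: chilbert_space
begin

definition scaleC_complex :: "complex \<Rightarrow> complex \<Rightarrow> complex" where
  "scaleC_complex c x = c * x"

definition cinner_complex :: "complex \<Rightarrow> complex \<Rightarrow> complex" where
  "cinner_complex x y = cnj x * y"

instance
  by standard
    (auto simp: scaleC_complex_def cinner_complex_def algebra_simps scaleR_conv_of_real
      complex_norm_square simp del: of_real_power)

end


section \<open>Bounded operators\<close>

text \<open>Elements of $B(H)$ are the bounded real-linear maps satisfying \<open>clinear_op\<close>.  Throughout, an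
  operator $K \to L$ between closed subspaces of $H$ is identified with the operator on $H$ that
  extends it by zero on $K^\perp$ (\<open>op_between\<close>).  Norms, adjoints, positivity and positive square
  roots are compatible with this identification.\<close>

type_synonym 'h op = "'h \<Rightarrow>\<^sub>L 'h"

definition clinear_op :: "'h::chilbert_space op \<Rightarrow> bool" where
  "clinear_op A \<longleftrightarrow> (\<forall>c x. blinfun_apply A (c *\<^sub>C x) = c *\<^sub>C blinfun_apply A x)"

definition adj_op :: "'h::chilbert_space op \<Rightarrow> 'h op" where
  "adj_op A = (THE B. clinear_op B \<and>
     (\<forall>x y. cinner (blinfun_apply A x) y = cinner x (blinfun_apply B y)))"

definition selfadjoint_op :: "'h::chilbert_space op \<Rightarrow> bool" where
  "selfadjoint_op A \<longleftrightarrow> clinear_op A \<and>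
     (\<forall>x y. cinner (blinfun_apply A x) y = cinner x (blinfun_apply A y))"

definition nonneg_on :: "'h::chilbert_space set \<Rightarrow> 'h op \<Rightarrow> bool" where
  "nonneg_on K A \<longleftrightarrow>
     (\<forall>x\<in>K. cinner x (blinfun_apply A x) \<in> \<real> \<and> 0 \<le> Re (cinner x (blinfun_apply A x)))"

definition positive_op :: "'h::chilbert_space op \<Rightarrow> bool" where
  "positive_op A \<longleftrightarrow> clinear_op A \<and> nonneg_on UNIV A"

definition sqrt_op :: "'h::chilbert_space op \<Rightarrow> 'h op" where
  "sqrt_op A = (THE B. positive_op B \<and> B o\<^sub>L B = A)"

definition op_between :: "'h::chilbert_space set \<Rightarrow> 'h set \<Rightarrow> 'h op \<Rightarrow> bool" where
  "op_between K L T \<longleftrightarrow> clinear_op T \<and> range (blinfun_apply T) \<subseteq> L \<and>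
     (\<forall>x. (\<forall>k\<in>K. cinner k x = 0) \<longrightarrow> blinfun_apply T x = 0)"


section \<open>POVMs on the sequence space\<close>

text \<open>The coordinate $x_i$ of a sequence, $i \ge 1$, is \<open>x (i - 1)\<close>.  Finite words are the elements
  of \<open>lists {..<m}\<close>; families indexed by words are functions whose values elsewhere are ignored.\<close>

definition Omega :: "nat \<Rightarrow> (nat \<Rightarrow> nat) measure" where
  "Omega m = Pi\<^sub>M UNIV (\<lambda>_. count_space {..<m})"

definition cyl :: "nat \<Rightarrow> nat list \<Rightarrow> (nat \<Rightarrow> nat) set" where
  "cyl m w = {x \<in> space (Omega m). \<forall>i<length w. x i = w ! i}"

text \<open>A POVM has the Borel $\sigma$-algebra as its domain; \<open>extensional\<close> fixes the value of the
  representing function outside of it, so that POVMs are equal iff they agree on Borel sets.\<close>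

definition povm :: "nat \<Rightarrow> ((nat \<Rightarrow> nat) set \<Rightarrow> 'h::chilbert_space op) \<Rightarrow> bool" where
  "povm m E \<longleftrightarrow>
     E \<in> extensional (sets (Omega m)) \<and>
     (\<forall>A\<in>sets (Omega m). positive_op (E A)) \<and>
     (\<forall>A :: nat \<Rightarrow> (nat \<Rightarrow> nat) set. range A \<subseteq> sets (Omega m) \<longrightarrow> disjoint_family A \<longrightarrow>
        (\<forall>x y. (\<lambda>n. cinner x (blinfun_apply (E (A n)) y)) sums
                 cinner x (blinfun_apply (E (\<Union>n. A n)) y))) \<and>
     E (space (Omega m)) = id_blinfun"

definition povm_with_cyl ::
    "nat \<Rightarrow> (nat list \<Rightarrow> 'h::chilbert_space op) \<Rightarrow> (nat \<Rightarrow> nat) set \<Rightarrow> 'h op" where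
  "povm_with_cyl m G = (THE F. povm m F \<and> (\<forall>w\<in>lists {..<m}. F (cyl m w) = G w))"


section \<open>Range martingales\<close>

definition root_cyl ::
    "nat \<Rightarrow> ((nat \<Rightarrow> nat) set \<Rightarrow> 'h::chilbert_space op) \<Rightarrow> nat list \<Rightarrow> 'h op" where
  "root_cyl m E w = sqrt_op (E (cyl m w))"

definition range_space ::
    "nat \<Rightarrow> ((nat \<Rightarrow> nat) set \<Rightarrow> 'h::chilbert_space op) \<Rightarrow> nat list \<Rightarrow> 'h set" where
  "range_space m E w = closure (range (blinfun_apply (root_cyl m E w)))"

text \<open>The edge contraction $K_w \to K_{wj}$ determined by a family $S_w : H \to K_w$ of operators with
  dense ranges: $S_w = E_w^{1/2}$ yields $C_{wj}$, and $S_w = S^X_w$ yields $C^X_{wj}$.\<close>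

definition edge_contraction ::
    "(nat list \<Rightarrow> 'h::chilbert_space set) \<Rightarrow> (nat list \<Rightarrow> 'h op) \<Rightarrow> nat list \<Rightarrow> nat \<Rightarrow> 'h op" where
  "edge_contraction K S w j = (THE C. op_between (K w) (K (w @ [j])) C \<and> norm C \<le> 1 \<and>
     (\<forall>h. blinfun_apply C (blinfun_apply (S w) h) = blinfun_apply (S (w @ [j])) h))"

definition martingale_along ::
    "nat \<Rightarrow> (nat list \<Rightarrow> 'h::chilbert_space set) \<Rightarrow> (nat list \<Rightarrow> 'h op) \<Rightarrow>
       (nat list \<Rightarrow> 'h op) \<Rightarrow> bool" where
  "martingale_along m K S X \<longleftrightarrow>
     (\<forall>w\<in>lists {..<m}. op_between (K w) (K w) (X w) \<and> selfadjoint_op (X w)) \<and>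
     (\<forall>w\<in>lists {..<m}. X w =
        (\<Sum>j<m. adj_op (edge_contraction K S w j) o\<^sub>L X (w @ [j]) o\<^sub>L edge_contraction K S w j))"

definition strictly_positive_on ::
    "nat \<Rightarrow> (nat list \<Rightarrow> 'h::chilbert_space set) \<Rightarrow> (nat list \<Rightarrow> 'h op) \<Rightarrow> bool" where
  "strictly_positive_on m K X \<longleftrightarrow>
     (\<exists>a b :: real. 0 < a \<and> a \<le> b \<and>
        (\<forall>w\<in>lists {..<m}. nonneg_on (K w) (X w - a *\<^sub>R id_blinfun) \<and>
                          nonneg_on (K w) (b *\<^sub>R id_blinfun - X w)))"

definition bounded_range_martingale ::
    "nat \<Rightarrow> ((nat \<Rightarrow> nat) set \<Rightarrow> 'h::chilbert_space op) \<Rightarrow> (nat list \<Rightarrow> 'h op) \<Rightarrow> bool" where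
  "bounded_range_martingale m E X \<longleftrightarrow>
     bdd_above ((\<lambda>w. norm (X w)) ` lists {..<m}) \<and>
     martingale_along m (range_space m E) (root_cyl m E) X"

definition strictly_positive_normalized_range_martingale ::
    "nat \<Rightarrow> ((nat \<Rightarrow> nat) set \<Rightarrow> 'h::chilbert_space op) \<Rightarrow> (nat list \<Rightarrow> 'h op) \<Rightarrow> bool" where
  "strictly_positive_normalized_range_martingale m E X \<longleftrightarrow>
     bounded_range_martingale m E X \<and> strictly_positive_on m (range_space m E) X \<and>
     X [] = id_blinfun"

text \<open>The POVM $E^X$.\<close>

definition transform_povm ::
    "nat \<Rightarrow> ((nat \<Rightarrow> nat) set \<Rightarrow> 'h::chilbert_space op) \<Rightarrow> (nat list \<Rightarrow> 'h op) \<Rightarrow>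
       (nat \<Rightarrow> nat) set \<Rightarrow> 'h op" where
  "transform_povm m E X =
     povm_with_cyl m (\<lambda>w. root_cyl m E w o\<^sub>L X w o\<^sub>L root_cyl m E w)"


section \<open>Factor space coordinates for the transformed POVM\<close>

definition factor_map ::
    "nat \<Rightarrow> ((nat \<Rightarrow> nat) set \<Rightarrow> 'h::chilbert_space op) \<Rightarrow> (nat list \<Rightarrow> 'h op) \<Rightarrow>
       nat list \<Rightarrow> 'h op" where
  "factor_map m E X w = sqrt_op (X w) o\<^sub>L root_cyl m E w"

text \<open>$Y$ is a strictly positive normalized range martingale for $E^X$ in factor space coordinates.
  The spaces are those of $E$; $E^X$ enters through its factorization
  $E^X([w]) = (S^X_w)^* S^X_w$.\<close>

definition factor_range_martingale ::
    "nat \<Rightarrow> ((nat \<Rightarrow> nat) set \<Rightarrow> 'h::chilbert_space op) \<Rightarrow> (nat list \<Rightarrow> 'h op) \<Rightarrow>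
       (nat list \<Rightarrow> 'h op) \<Rightarrow> bool" where
  "factor_range_martingale m E X Y \<longleftrightarrow>
     martingale_along m (range_space m E) (factor_map m E X) Y \<and>
     strictly_positive_on m (range_space m E) Y \<and> Y [] = id_blinfun"

text \<open>The POVM $(E^X)^Y$.\<close>

definition factor_transform_povm ::
    "nat \<Rightarrow> ((nat \<Rightarrow> nat) set \<Rightarrow> 'h::chilbert_space op) \<Rightarrow> (nat list \<Rightarrow> 'h op) \<Rightarrow>
       (nat list \<Rightarrow> 'h op) \<Rightarrow> (nat \<Rightarrow> nat) set \<Rightarrow> 'h op" where
  "factor_transform_povm m E X Y =
     povm_with_cyl m (\<lambda>w. adj_op (factor_map m E X w) o\<^sub>L Y w o\<^sub>L factor_map m E X w)"

end

theory Submission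
  imports Defs
begin

text \<open>Write \<open>R\<^sub>w = E\<^sub>w\<^sup>1\<^sup>/\<^sup>2\<close>, \<open>Q\<^sub>w = X\<^sub>w\<^sup>1\<^sup>/\<^sup>2\<close>, and let \<open>C\<close> and \<open>D\<close> be the edge contractions of \<open>E\<close> and
  of its transform by \<open>X\<close>.  For an edge from \<open>w\<close> to a child \<open>v\<close>, both \<open>D Q\<^sub>w\<close> and \<open>Q\<^sub>v C\<close> send
  \<open>R\<^sub>w h\<close> to \<open>Q\<^sub>v R\<^sub>v h\<close> and vanish on the orthogonal complement of \<open>H\<^sub>w\<close>; since the range of
  \<open>R\<^sub>w\<close> is dense in \<open>H\<^sub>w\<close>, they coincide.  Multiplying the martingale identity of \<open>Y\<close> by \<open>Q\<^sub>w\<close> on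
  both sides and moving each \<open>Q\<^sub>w\<close> through the contractions by \<open>D Q\<^sub>w = Q\<^sub>v C\<close> and its adjoint gives
  the martingale identity of \<open>Z\<close>.  The bounds for \<open>Z\<close> are the products of those for \<open>X\<close> and \<open>Y\<close>,
  because \<open>\<langle>x, Z\<^sub>w x\<rangle> = \<langle>Q\<^sub>w x, Y\<^sub>w Q\<^sub>w x\<rangle>\<close> and \<open>\<parallel>Q\<^sub>w x\<parallel>\<^sup>2 = \<langle>x, X\<^sub>w x\<rangle>\<close>.  The two POVMs are described
  by the same cylinder values, \<open>(Q\<^sub>w R\<^sub>w)\<^sup>* Y\<^sub>w Q\<^sub>w R\<^sub>w = R\<^sub>w Z\<^sub>w R\<^sub>w\<close>, hence equal; the existence of such
  a POVM plays no role.

  The adjoints, square roots and edge contractions are given by definite descriptions, so each of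
  them requires existence and uniqueness.  Orthogonal projections and the Riesz theorem come from
  one minimisation argument (\<open>functional_representation\<close>); adjoints follow from Riesz.  Square roots
  are limits of a norm-convergent iteration (\<open>sqrt_exists\<close>, \<open>commuting_sqrt_unique\<close>).  Edge
  contractions are continuous extensions (\<open>contraction_extension\<close>); the norm bound that they need
  is \<open>E\<^sub>v \<le> E\<^sub>w\<close> for \<open>C\<close> and the martingale identity of \<open>X\<close> for \<open>D\<close>, and the dense range of \<open>Q\<^sub>w R\<^sub>w\<close> in
  \<open>H\<^sub>w\<close> comes from the strict positivity of \<open>X\<^sub>w\<close> (\<open>closure_range_sqrt_compose\<close>).\<close>


section \<open>The inner product\<close>

text \<open>Makes the convergence of absolutely convergent series available, for bounded operators too.\<close>

instance chilbert_space \<subseteq> banach ..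

lemma scaleC_zero_right [simp]: "c *\<^sub>C (0::'a::complex_inner) = 0"
  using scaleC_add_right[of c 0 0] by simp

lemma scaleC_minus_right: "c *\<^sub>C (- x) = - (c *\<^sub>C (x::'a::complex_inner))"
  using scaleC_add_right[of c "- x" x] by (simp add: eq_neg_iff_add_eq_0)

lemma scaleC_diff_right: "c *\<^sub>C (x - y) = c *\<^sub>C x - c *\<^sub>C (y::'a::complex_inner)"
  using scaleC_add_right[of c x "- y"] by (simp add: scaleC_minus_right)

lemma cinner_add_left: "cinner (x + y) z = cinner x z + cinner y (z::'a::complex_inner)"
  by (metis cinner_add_right cinner_commute complex_cnj_add)

lemma cinner_scaleC_left: "cinner (c *\<^sub>C x) y = cnj c * cinner x (y::'a::complex_inner)"
  by (metis cinner_commute cinner_scaleC_right complex_cnj_mult)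

lemma cinner_scaleR_right: "cinner x (r *\<^sub>R y) = of_real r * cinner x (y::'a::complex_inner)"
  by (metis cinner_scaleC_right scaleC_of_real)

lemma cinner_scaleR_left: "cinner (r *\<^sub>R x) y = of_real r * cinner x (y::'a::complex_inner)"
  by (metis cinner_scaleC_left scaleC_of_real complex_cnj_complex_of_real)

lemma cinner_zero_right [simp]: "cinner x (0::'a::complex_inner) = 0"
  using cinner_add_right[of x 0 0] by simp

lemma cinner_zero_left [simp]: "cinner (0::'a::complex_inner) x = 0"
  using cinner_add_left[of 0 0 x] by simp

lemma cinner_minus_right: "cinner x (- y) = - cinner x (y::'a::complex_inner)"
  using cinner_add_right[of x "- y" y] by (simp add: eq_neg_iff_add_eq_0)

lemma cinner_minus_left: "cinner (- x) y = - cinner x (y::'a::complex_inner)"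
  using cinner_add_left[of "- x" x y] by (simp add: eq_neg_iff_add_eq_0)

lemma cinner_diff_right: "cinner x (y - z) = cinner x y - cinner x (z::'a::complex_inner)"
  using cinner_add_right[of x y "- z"] by (simp add: cinner_minus_right)

lemma cinner_diff_left: "cinner (x - y) z = cinner x z - cinner y (z::'a::complex_inner)"
  using cinner_add_left[of x "- y" z] by (simp add: cinner_minus_left)

lemmas cinner_simps = cinner_add_left cinner_add_right cinner_diff_left cinner_diff_right
  cinner_minus_left cinner_minus_right cinner_scaleC_left cinner_scaleC_right
  cinner_scaleR_left cinner_scaleR_right

lemma Re_cinner_commute: "Re (cinner x y) = Re (cinner y (x::'a::complex_inner))"
  by (metis cinner_commute cnj.simps(1))

lemma Re_cinner_self: "Re (cinner x x) = (norm (x::'a::complex_inner))\<^sup>2"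
  by (simp add: cinner_self)

lemma norm_scaleC: "norm (c *\<^sub>C (x::'a::complex_inner)) = cmod c * norm x"
proof -
  have "complex_of_real ((norm (c *\<^sub>C x))\<^sup>2) = (cnj c * c) * cinner x x"
    by (simp add: cinner_self[symmetric] cinner_simps del: of_real_power)
  also have "\<dots> = complex_of_real ((cmod c * norm x)\<^sup>2)"
    by (simp add: cinner_self complex_norm_square[symmetric] mult.commute power_mult_distrib
        flip: complex_norm_square)
  finally have "(norm (c *\<^sub>C x))\<^sup>2 = (cmod c * norm x)\<^sup>2"
    by (simp only: of_real_eq_iff)
  then show ?thesis by (simp add: power2_eq_iff_nonneg)
qed

lemma norm_diff_square:
  "(norm (x - y))\<^sup>2 = (norm x)\<^sup>2 - 2 * Re (cinner x y) + (norm (y::'a::complex_inner))\<^sup>2"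
  by (simp add: Re_cinner_commute[of y x] cinner_simps flip: Re_cinner_self)

lemma norm_add_square:
  "(norm (x + y))\<^sup>2 = (norm x)\<^sup>2 + 2 * Re (cinner x y) + (norm (y::'a::complex_inner))\<^sup>2"
  by (simp add: Re_cinner_commute[of y x] cinner_simps flip: Re_cinner_self)

lemma norm_orthogonal_component_le:
  assumes "cinner p (x - p) = 0"
  shows "norm p \<le> norm (x::'a::complex_inner)"
proof (rule power2_le_imp_le)
  show "(norm p)\<^sup>2 \<le> (norm x)\<^sup>2"
    using norm_add_square[of p "x - p"] assms by simp
qed simp

lemma cinner_right_eqI:
  assumes "\<And>x. Re (cinner x y) = Re (cinner x z)"
  shows "y = (z::'a::complex_inner)"
proof -
  have "Re (cinner (y - z) (y - z)) = 0"
    using assms[of "y - z"] by (simp add: cinner_simps)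
  then show ?thesis by (simp add: Re_cinner_self)
qed

lemma quadratic_nonneg_discriminant:
  fixes a b c :: real
  assumes "\<And>t. 0 \<le> a + 2 * t * b + t\<^sup>2 * c" and "0 \<le> c"
  shows "b\<^sup>2 \<le> a * c"
proof (cases "c = 0")
  case True
  have "b = 0"
  proof (rule ccontr)
    assume "b \<noteq> 0"
    then show False using assms(1)[of "- (a + 1) / (2 * b)"] True by (simp add: field_simps)
  qed
  then show ?thesis using True by simp
next
  case False
  then have c: "0 < c" using assms(2) by simp
  have "a + 2 * (- b / c) * b + (- b / c)\<^sup>2 * c = a - b\<^sup>2 / c"
    using c by (simp add: field_simps power2_eq_square)
  then have "b\<^sup>2 / c \<le> a" using assms(1)[of "- b / c"] by simp
  then show ?thesis using c by (simp add: field_simps)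
qed

lemma Re_cinner_le_norm: "Re (cinner x y) \<le> norm x * norm (y::'a::complex_inner)"
proof -
  have "0 \<le> (norm x)\<^sup>2 + 2 * t * Re (cinner x y) + t\<^sup>2 * (norm y)\<^sup>2" for t
    using norm_add_square[of x "t *\<^sub>R y"] zero_le_power2[of "norm (x + t *\<^sub>R y)"]
    by (simp add: cinner_simps power_mult_distrib)
  then have "(Re (cinner x y))\<^sup>2 \<le> (norm x)\<^sup>2 * (norm y)\<^sup>2"
    by (intro quadratic_nonneg_discriminant) auto
  then have "(Re (cinner x y))\<^sup>2 \<le> (norm x * norm y)\<^sup>2"
    by (simp add: power_mult_distrib)
  then show ?thesis by (rule power2_le_imp_le) simp
qed

lemma cmod_cinner_le_norm: "cmod (cinner x y) \<le> norm x * norm (y::'a::complex_inner)"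
proof (cases "cinner x y = 0")
  case False
  define c where "c = cnj (cinner x y) / cmod (cinner x y)"
  have c: "cmod c = 1" using False by (simp add: c_def norm_divide)
  have "cinner x (c *\<^sub>C y) = cnj (cinner x y) * cinner x y / cmod (cinner x y)"
    by (simp add: cinner_simps c_def)
  also have "\<dots> = cmod (cinner x y)"
    using False by (simp add: complex_norm_square[symmetric] mult.commute power2_eq_square)
  finally have "cmod (cinner x y) = Re (cinner x (c *\<^sub>C y))" by simp
  also have "\<dots> \<le> norm x * norm (c *\<^sub>C y)" by (rule Re_cinner_le_norm)
  finally show ?thesis by (simp add: norm_scaleC c)
qed simp

lemma bounded_bilinear_cinner: "bounded_bilinear (cinner :: 'a::complex_inner \<Rightarrow> 'a \<Rightarrow> complex)"
  by (rule bounded_bilinear.intro)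
    (auto simp: cinner_simps scaleR_conv_of_real intro!: exI[of _ 1] cmod_cinner_le_norm)

lemma bounded_linear_scaleC: "bounded_linear (\<lambda>x::'a::complex_inner. c *\<^sub>C x)"
proof (rule bounded_linear_intro)
  show "c *\<^sub>C (r *\<^sub>R x) = r *\<^sub>R (c *\<^sub>C x)" for r and x :: 'a
    by (simp flip: scaleC_of_real add: scaleC_scaleC mult.commute)
  show "norm (c *\<^sub>C x) \<le> norm x * cmod c" for x :: 'a
    by (simp add: norm_scaleC mult.commute)
qed (rule scaleC_add_right)

lemma bounded_linear_Re_cinner_left: "bounded_linear (\<lambda>k. Re (cinner k (x::'a::complex_inner)))"
  by (intro bounded_linear_compose[OF bounded_linear_Re]
      bounded_bilinear.bounded_linear_left[OF bounded_bilinear_cinner])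


section \<open>Projections and the Riesz representation\<close>

text \<open>Closed complex subspaces.  The library's \<open>subspace\<close> is real-linear, so closure under complex
  scalars is a separate clause.\<close>

definition closed_csubspace :: "'a::complex_inner set \<Rightarrow> bool" where
  "closed_csubspace K \<longleftrightarrow> closed K \<and> subspace K \<and> (\<forall>c. \<forall>x\<in>K. c *\<^sub>C x \<in> K)"

lemma closure_csubspace:
  fixes K :: "'a::complex_inner set"
  assumes "subspace K" and c: "\<And>c x. x \<in> K \<Longrightarrow> c *\<^sub>C x \<in> K"
  shows "closed_csubspace (closure K)"
  unfolding closed_csubspace_def subspace_def
proof (intro conjI allI ballI)
  show "0 \<in> closure K" using assms(1) by (auto simp: subspace_def intro: closure_subset[THEN subsetD])
  have sc: "c *\<^sub>C x \<in> closure K" if x: "x \<in> closure K" for c x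
  proof -
    obtain f where f: "\<And>n. f n \<in> K" "f \<longlonglongrightarrow> x" using x unfolding closure_sequential by blast
    show ?thesis
      unfolding closure_sequential
      using c[OF f(1)] bounded_linear.tendsto[OF bounded_linear_scaleC f(2)]
      by (intro exI[of _ "\<lambda>n. c *\<^sub>C f n"]) simp
  qed
  then show "c *\<^sub>C x \<in> closure K" if "x \<in> closure K" for c x using that .
  show "c *\<^sub>R x \<in> closure K" if "x \<in> closure K" for c x
    using sc[OF that] by (simp flip: scaleC_of_real)
  show "x + y \<in> closure K" if x: "x \<in> closure K" and y: "y \<in> closure K" for x y
  proof -
    obtain f where f: "\<And>n. f n \<in> K" "f \<longlonglongrightarrow> x" using x unfolding closure_sequential by blast
    obtain g where g: "\<And>n. g n \<in> K" "g \<longlonglongrightarrow> y" using y unfolding closure_sequential by blast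
    have "\<And>n. f n + g n \<in> K" using f(1) g(1) assms(1) by (simp add: subspace_add)
    then show ?thesis
      unfolding closure_sequential using tendsto_add[OF f(2) g(2)]
      by (intro exI[of _ "\<lambda>n. f n + g n"]) simp
  qed
qed simp

text \<open>The minimiser of \<open>\<parallel>k\<parallel>\<^sup>2 - 2 f k\<close> over a closed subspace represents \<open>f\<close> there.  The
  orthogonal projection (\<open>f = Re \<langle>\<cdot>, x\<rangle>\<close>) and the Riesz theorem (\<open>K = UNIV\<close>) are both
  special cases.\<close>

lemma functional_representation:
  fixes K :: "'a::chilbert_space set"
  assumes "closed K" and K: "subspace K" and "bounded_linear f"
  shows "\<exists>u\<in>K. \<forall>k\<in>K. Re (cinner k u) = f k"
proof -
  interpret f: bounded_linear f by fact
  define J where "J k = (norm k)\<^sup>2 - 2 * f k" for k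
  obtain c where c: "\<And>k. norm (f k) \<le> norm k * c" using f.bounded by blast
  have low: "- c\<^sup>2 \<le> J k" for k
  proof -
    have "f k \<le> norm k * c" using c[of k] by simp
    moreover have "0 \<le> (norm k - c)\<^sup>2" by simp
    ultimately show ?thesis by (simp add: J_def power2_diff)
  qed
  then have bdd: "bdd_below (J ` K)" by (auto intro!: bdd_belowI)
  have ne: "J ` K \<noteq> {}" using subspace_0[OF K] by auto
  define d where "d = Inf (J ` K)"
  have d: "d \<le> J k" if "k \<in> K" for k
    unfolding d_def using that bdd by (intro cInf_lower) auto
  have "\<exists>k\<in>K. J k < d + inverse (real (Suc n))" for n
    using cInf_lessD[OF ne, of "d + inverse (real (Suc n))"] unfolding d_def by auto
  then obtain k where k: "\<And>n. k n \<in> K" "\<And>n. J (k n) < d + inverse (real (Suc n))"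
    by metis
  have par: "(norm (x - y))\<^sup>2 \<le> 2 * (J x - d) + 2 * (J y - d)" if "x \<in> K" "y \<in> K" for x y
  proof -
    have "(1/2) *\<^sub>R (x + y) \<in> K" using that K by (simp add: subspace_add subspace_scale)
    then have "d \<le> J ((1/2) *\<^sub>R (x + y))" by (rule d)
    also have "\<dots> = (norm (x + y))\<^sup>2 / 4 - (f x + f y)"
      by (simp add: J_def f.scaleR f.add power_divide add_divide_distrib)
    finally show ?thesis
      using norm_diff_square[of x y] norm_add_square[of x y] by (simp add: J_def field_simps)
  qed
  have "Cauchy k"
  proof (rule metric_CauchyI)
    fix e :: real assume "0 < e"
    then obtain N where N: "inverse (real (Suc N)) < e\<^sup>2 / 4"
      using reals_Archimedean[of "e\<^sup>2 / 4"] by auto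
    have "dist (k n) (k p) < e" if "N \<le> n" "N \<le> p" for n p
    proof -
      have *: "J (k q) - d < e\<^sup>2 / 4" if "N \<le> q" for q
      proof -
        have "inverse (real (Suc q)) \<le> inverse (real (Suc N))" using that by simp
        then show ?thesis using k(2)[of q] N by linarith
      qed
      have "(norm (k n - k p))\<^sup>2 < e\<^sup>2"
        using par[OF k(1)[of n] k(1)[of p]] *[OF that(1)] *[OF that(2)] by argo
      then show ?thesis using \<open>0 < e\<close> unfolding dist_norm by (auto intro: power2_less_imp_less)
    qed
    then show "\<exists>M. \<forall>m\<ge>M. \<forall>n\<ge>M. dist (k m) (k n) < e" by blast
  qed
  then obtain u where u: "k \<longlonglongrightarrow> u" using Cauchy_convergent convergent_def by blast
  have uK: "u \<in> K" using closed_sequentially[OF assms(1) _ u] k(1) by blast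
  have "(\<lambda>n. J (k n)) \<longlonglongrightarrow> J u"
    unfolding J_def using u by (intro tendsto_intros f.tendsto)
  moreover have "(\<lambda>n. d + inverse (real (Suc n))) \<longlonglongrightarrow> d + 0"
    by (intro tendsto_intros LIMSEQ_inverse_real_of_nat)
  ultimately have "J u \<le> d + 0"
    by (rule LIMSEQ_le) (use k(2) less_imp_le in blast)
  then have min: "J u \<le> d" by simp
  have "Re (cinner x u) = f x" if "x \<in> K" for x
  proof -
    have "0 \<le> 0 + 2 * t * (Re (cinner u x) - f x) + t\<^sup>2 * (norm x)\<^sup>2" for t
    proof -
      have "u + t *\<^sub>R x \<in> K" using that uK K by (simp add: subspace_add subspace_scale)
      from d[OF this] min have "J u \<le> J (u + t *\<^sub>R x)" by simp
      then show ?thesis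
        by (simp add: J_def norm_add_square f.add f.scaleR cinner_simps power_mult_distrib algebra_simps)
    qed
    from quadratic_nonneg_discriminant[OF this] show ?thesis
      by (simp add: Re_cinner_commute)
  qed
  with uK show ?thesis by blast
qed

lemma orthogonal_decomposition:
  fixes K :: "'a::chilbert_space set"
  assumes K: "closed_csubspace K"
  obtains p where "p \<in> K" "\<And>k. k \<in> K \<Longrightarrow> cinner k (x - p) = 0"
proof -
  have sub: "closed K" "subspace K" and sc: "\<And>c x. x \<in> K \<Longrightarrow> c *\<^sub>C x \<in> K"
    using K by (auto simp: closed_csubspace_def)
  obtain p where p: "p \<in> K" "\<And>k. k \<in> K \<Longrightarrow> Re (cinner k p) = Re (cinner k x)"
    using functional_representation[OF sub bounded_linear_Re_cinner_left[of x]] by blast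
  have "cinner k (x - p) = 0" if "k \<in> K" for k
    using p(2)[OF that] p(2)[OF sc[OF that, of \<i>]]
    by (simp add: cinner_simps complex_eq_iff)
  with p(1) that show ?thesis by blast
qed

text \<open>A closed subspace contains its double orthogonal complement.\<close>

lemma orthogonal_orthogonal:
  fixes K :: "'a::chilbert_space set"
  assumes K: "closed_csubspace K"
    and orth: "\<And>y. (\<And>k. k \<in> K \<Longrightarrow> cinner k y = 0) \<Longrightarrow> cinner y x = 0"
  shows "x \<in> K"
proof -
  obtain p where p: "p \<in> K" "\<And>k. k \<in> K \<Longrightarrow> cinner k (x - p) = 0"
    using orthogonal_decomposition[OF K] by blast
  have "cinner (x - p) x = 0" by (rule orth) (rule p(2))
  moreover have "cinner (x - p) p = 0"
    by (metis p cinner_commute complex_cnj_zero)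
  ultimately have "cinner (x - p) (x - p) = 0" by (simp add: cinner_diff_right)
  then have "x = p" by (simp add: cinner_self)
  then show ?thesis using p(1) by simp
qed


section \<open>Bounded operators and adjoints\<close>

text \<open>A total, bounded and complex-linear relation is the graph of a bounded operator.  Adjoints and edge
  contractions arise in this way.\<close>

lemma bounded_operator_of_relation:
  fixes R :: "'a::chilbert_space \<Rightarrow> 'a \<Rightarrow> bool"
  assumes total: "\<And>x. \<exists>y. R x y"
    and add: "\<And>x y u v. R x u \<Longrightarrow> R y v \<Longrightarrow> R (x + y) (u + v)"
    and scale: "\<And>c x u. R x u \<Longrightarrow> R (c *\<^sub>C x) (c *\<^sub>C u)"
    and bound: "\<And>x u. R x u \<Longrightarrow> norm u \<le> c * norm x" and "0 \<le> c"
  shows "\<exists>B. clinear_op B \<and> norm B \<le> c \<and> (\<forall>x u. R x u \<longleftrightarrow> u = blinfun_apply B x)"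
proof -
  have unique: "u = v" if "R x u" "R x v" for x u v
  proof -
    have "(- 1) *\<^sub>C z = - z" for z :: 'a
      using scaleC_of_real[of "-1" z] by simp
    then have "R (x + - x) (u + - v)" using add[OF that(1) scale[OF that(2), of "-1"]] by simp
    then show ?thesis using bound by force
  qed
  obtain g where g: "\<And>x. R x (g x)" using total by metis
  have gs: "g (a *\<^sub>C x) = a *\<^sub>C g x" for a x using unique[OF g scale[OF g]] .
  have lin: "bounded_linear g"
  proof (rule bounded_linear_intro)
    show "g (x + y) = g x + g y" for x y using unique[OF g add[OF g g]] .
    show "g (r *\<^sub>R x) = r *\<^sub>R g x" for r x using gs[of "of_real r" x] by (simp add: scaleC_of_real)
    show "norm (g x) \<le> norm x * c" for x using bound[OF g] by (simp add: mult.commute)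
  qed
  show ?thesis
  proof (intro exI[of _ "Blinfun g"] conjI allI iffI)
    show "clinear_op (Blinfun g)" by (simp add: clinear_op_def bounded_linear_Blinfun_apply[OF lin] gs)
    show "norm (Blinfun g) \<le> c"
      using bound[OF g] \<open>0 \<le> c\<close> by (intro norm_blinfun_bound) (auto simp: bounded_linear_Blinfun_apply[OF lin])
    show "R x u" if "u = blinfun_apply (Blinfun g) x" for x u
      using g that by (simp add: bounded_linear_Blinfun_apply[OF lin])
    show "u = blinfun_apply (Blinfun g) x" if "R x u" for x u
      using unique[OF that g] by (simp add: bounded_linear_Blinfun_apply[OF lin])
  qed
qed

lemma clinear_op_apply: "clinear_op A \<Longrightarrow> blinfun_apply A (c *\<^sub>C x) = c *\<^sub>C blinfun_apply A x"
  by (simp add: clinear_op_def)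

lemma blinfun_compose_assoc: "(A o\<^sub>L B) o\<^sub>L C = A o\<^sub>L (B o\<^sub>L C)"
  by (rule blinfun_eqI) simp

lemma clinear_op_compose: "clinear_op A \<Longrightarrow> clinear_op B \<Longrightarrow> clinear_op (A o\<^sub>L B)"
  by (simp add: clinear_op_def)

lemma clinear_op_add: "clinear_op A \<Longrightarrow> clinear_op B \<Longrightarrow> clinear_op (A + B)"
  by (simp add: clinear_op_def blinfun.add_left scaleC_add_right)

lemma clinear_op_diff: "clinear_op A \<Longrightarrow> clinear_op B \<Longrightarrow> clinear_op (A - B)"
  by (simp add: clinear_op_def blinfun.diff_left scaleC_diff_right)

lemma clinear_op_scaleR: "clinear_op A \<Longrightarrow> clinear_op (r *\<^sub>R A)"
  by (simp add: clinear_op_def blinfun.scaleR_left linear_simps(5)[OF bounded_linear_scaleC])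

lemma clinear_op_id [simp]: "clinear_op id_blinfun"
  by (simp add: clinear_op_def)

lemma clinear_op_zero [simp]: "clinear_op 0"
  by (simp add: clinear_op_def)

text \<open>Real parts suffice, because \<open>x\<close> may be multiplied by the imaginary unit.\<close>

lemma cinner_eq_if_Re_eq:
  assumes "clinear_op A" "\<And>x. Re (cinner (blinfun_apply A x) y) = Re (cinner x z)"
  shows "cinner (blinfun_apply A x) y = cinner x z"
  using assms(2)[of x] assms(2)[of "\<i> *\<^sub>C x"]
  by (simp add: clinear_op_apply[OF assms(1)] cinner_simps complex_eq_iff)

lemma adjoint_exists:
  assumes A: "clinear_op A"
  shows "\<exists>B. clinear_op B \<and> (\<forall>x y. cinner (blinfun_apply A x) y = cinner x (blinfun_apply B y))"
proof -
  define R where "R y z \<longleftrightarrow> (\<forall>x. cinner (blinfun_apply A x) y = cinner x z)" for y z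
  have 1: "\<exists>z. R y z" for y
  proof -
    have "bounded_linear (\<lambda>x. Re (cinner (blinfun_apply A x) y))"
      by (intro bounded_linear_compose[OF bounded_linear_Re_cinner_left] blinfun.bounded_linear_right)
    from functional_representation[OF closed_UNIV subspace_UNIV this]
    obtain z where "\<And>x. Re (cinner x z) = Re (cinner (blinfun_apply A x) y)" by auto
    then show ?thesis
      unfolding R_def using cinner_eq_if_Re_eq[OF A] by metis
  qed
  have 2: "R (x + y) (u + v)" if "R x u" "R y v" for x y u v
    using that by (simp add: R_def cinner_simps)
  have 3: "R (c *\<^sub>C x) (c *\<^sub>C u)" if "R x u" for c x u
    using that by (simp add: R_def cinner_simps)
  have 4: "norm u \<le> norm A * norm y" if "R y u" for y u
  proof -
    have "norm u * norm u = Re (cinner (blinfun_apply A u) y)"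
      using that by (simp add: R_def Re_cinner_self power2_eq_square)
    also have "\<dots> \<le> norm (blinfun_apply A u) * norm y" by (rule Re_cinner_le_norm)
    also have "\<dots> \<le> norm A * norm u * norm y" by (intro mult_right_mono norm_blinfun) simp
    finally have "norm u * norm u \<le> norm u * (norm A * norm y)" by (simp add: mult_ac)
    then show ?thesis by (cases "norm u = 0") auto
  qed
  have "\<exists>B. clinear_op B \<and> norm B \<le> norm A \<and> (\<forall>y z. R y z \<longleftrightarrow> z = blinfun_apply B y)"
    by (rule bounded_operator_of_relation) (fact 1 2 3 4 norm_ge_zero)+
  then obtain B where B: "clinear_op B" and R: "\<forall>y z. R y z \<longleftrightarrow> z = blinfun_apply B y"
    by (elim exE conjE)
  have "R y (blinfun_apply B y)" for y using R by simp
  then show ?thesis unfolding R_def using B by blast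
qed

lemma adj_op_eqI:
  assumes "clinear_op B" "\<And>x y. cinner (blinfun_apply A x) y = cinner x (blinfun_apply B y)"
  shows "adj_op A = B"
  unfolding adj_op_def
proof (rule the_equality)
  fix B' assume B': "clinear_op B' \<and> (\<forall>x y. cinner (blinfun_apply A x) y = cinner x (blinfun_apply B' y))"
  show "B' = B"
  proof (rule blinfun_eqI, rule cinner_right_eqI)
    fix y x show "Re (cinner x (blinfun_apply B' y)) = Re (cinner x (blinfun_apply B y))"
      using assms(2)[of x y] B' by simp
  qed
qed (use assms in blast)

lemma
  assumes "clinear_op A"
  shows clinear_op_adj: "clinear_op (adj_op A)"
    and cinner_adj_op: "cinner (blinfun_apply A x) y = cinner x (blinfun_apply (adj_op A) y)"
proof -
  obtain B where B: "clinear_op B" "\<And>x y. cinner (blinfun_apply A x) y = cinner x (blinfun_apply B y)"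
    using adjoint_exists[OF assms] by blast
  then have "adj_op A = B" by (rule adj_op_eqI)
  with B show "clinear_op (adj_op A)" "cinner (blinfun_apply A x) y = cinner x (blinfun_apply (adj_op A) y)"
    by simp_all
qed

lemma adj_op_compose:
  assumes "clinear_op A" "clinear_op B"
  shows "adj_op (A o\<^sub>L B) = adj_op B o\<^sub>L adj_op A"
  using assms by (intro adj_op_eqI) (simp_all add: clinear_op_compose clinear_op_adj cinner_adj_op)

lemma adj_op_selfadjoint: "selfadjoint_op A \<Longrightarrow> adj_op A = A"
  by (rule adj_op_eqI) (auto simp: selfadjoint_op_def)

lemma selfadjoint_opD: "selfadjoint_op A \<Longrightarrow> cinner (blinfun_apply A x) y = cinner x (blinfun_apply A y)"
  by (simp add: selfadjoint_op_def)

lemma positive_op_selfadjoint: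
  assumes "positive_op A"
  shows "selfadjoint_op A"
proof -
  have lin: "clinear_op A" using assms by (simp add: positive_op_def)
  have im: "Im (cinner x (blinfun_apply A x)) = 0" for x
    using assms complex_is_Real_iff unfolding positive_op_def nonneg_on_def by blast
  have sum: "Im (cinner x (blinfun_apply A y)) + Im (cinner y (blinfun_apply A x)) = 0" for x y
    using im[of "x + y"] im[of x] im[of y] by (simp add: blinfun.add_right cinner_simps)
  have "cinner (blinfun_apply A x) y = cinner x (blinfun_apply A y)" for x y
    using sum[of x y] sum[of x "\<i> *\<^sub>C y"] cinner_commute[of "blinfun_apply A x" y]
    by (simp add: clinear_op_apply[OF lin] cinner_simps complex_eq_iff)
  with lin show ?thesis by (simp add: selfadjoint_op_def)
qed

text \<open>For a self-adjoint operator, realness of the quadratic form is automatic.\<close>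

lemma selfadjoint_form_real:
  assumes "selfadjoint_op A"
  shows "cinner x (blinfun_apply A x) \<in> \<real>"
  using cinner_commute[of x "blinfun_apply A x"] selfadjoint_opD[OF assms, of x x]
  by (simp add: Reals_cnj_iff)

lemma nonneg_on_selfadjoint:
  assumes "selfadjoint_op A"
  shows "nonneg_on K A \<longleftrightarrow> (\<forall>x\<in>K. 0 \<le> Re (cinner x (blinfun_apply A x)))"
  using selfadjoint_form_real[OF assms] by (auto simp: nonneg_on_def)

lemma positive_op_iff:
  "positive_op A \<longleftrightarrow> selfadjoint_op A \<and> (\<forall>x. 0 \<le> Re (cinner x (blinfun_apply A x)))"
  using nonneg_on_selfadjoint[of A UNIV] positive_op_selfadjoint
  by (auto simp: positive_op_def selfadjoint_op_def)

lemma selfadjoint_op_add: "selfadjoint_op A \<Longrightarrow> selfadjoint_op B \<Longrightarrow> selfadjoint_op (A + B)"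
  by (simp add: selfadjoint_op_def clinear_op_add blinfun.add_left cinner_simps)

lemma selfadjoint_op_diff: "selfadjoint_op A \<Longrightarrow> selfadjoint_op B \<Longrightarrow> selfadjoint_op (A - B)"
  by (simp add: selfadjoint_op_def clinear_op_diff blinfun.diff_left cinner_simps)

lemma selfadjoint_op_scaleR: "selfadjoint_op A \<Longrightarrow> selfadjoint_op (r *\<^sub>R A)"
  by (simp add: selfadjoint_op_def clinear_op_scaleR blinfun.scaleR_left cinner_simps)

lemma selfadjoint_op_id [simp]: "selfadjoint_op id_blinfun"
  by (simp add: selfadjoint_op_def)

lemma selfadjoint_op_zero [simp]: "selfadjoint_op 0"
  by (simp add: selfadjoint_op_def)

lemma selfadjoint_op_sandwich:
  assumes "selfadjoint_op A" "selfadjoint_op B"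
  shows "selfadjoint_op (A o\<^sub>L B o\<^sub>L A)"
  using assms by (simp add: selfadjoint_op_def clinear_op_compose)

lemma selfadjoint_op_compose_self: "selfadjoint_op A \<Longrightarrow> selfadjoint_op (A o\<^sub>L A)"
  by (simp add: selfadjoint_op_def clinear_op_compose)

lemma positive_op_cauchy_schwarz:
  assumes "positive_op A"
  shows "(Re (cinner x (blinfun_apply A y)))\<^sup>2
    \<le> Re (cinner x (blinfun_apply A x)) * Re (cinner y (blinfun_apply A y))"
proof (rule quadratic_nonneg_discriminant)
  have pos: "0 \<le> Re (cinner z (blinfun_apply A z))" for z
    using assms by (simp add: positive_op_iff)
  then show "0 \<le> Re (cinner y (blinfun_apply A y))" .
  have "Re (cinner y (blinfun_apply A x)) = Re (cinner x (blinfun_apply A y))"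
    using selfadjoint_opD[OF positive_op_selfadjoint[OF assms], of x y] Re_cinner_commute
    by metis
  then show "0 \<le> Re (cinner x (blinfun_apply A x)) + 2 * t * Re (cinner x (blinfun_apply A y))
      + t\<^sup>2 * Re (cinner y (blinfun_apply A y))" for t
    using pos[of "x + t *\<^sub>R y"]
    by (simp add: blinfun.add_right blinfun.scaleR_right cinner_simps power2_eq_square algebra_simps)
qed

lemma positive_op_form_zero:
  assumes "positive_op A" "Re (cinner x (blinfun_apply A x)) = 0"
  shows "blinfun_apply A x = 0"
  using positive_op_cauchy_schwarz[OF assms(1), of "blinfun_apply A x" x] assms(2)
  by (simp add: Re_cinner_self)

lemma positive_op_norm_le:
  assumes A: "positive_op A" and "0 \<le> c"
    and c: "\<And>x. Re (cinner x (blinfun_apply A x)) \<le> c * (norm x)\<^sup>2"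
  shows "norm A \<le> c"
proof (rule norm_blinfun_bound[OF \<open>0 \<le> c\<close>])
  fix x
  let ?y = "blinfun_apply A x"
  have "((norm ?y)\<^sup>2)\<^sup>2 \<le> Re (cinner ?y (blinfun_apply A ?y)) * Re (cinner x (blinfun_apply A x))"
    using positive_op_cauchy_schwarz[OF A, of ?y x] by (simp add: Re_cinner_self)
  also have "\<dots> \<le> (c * (norm ?y)\<^sup>2) * (c * (norm x)\<^sup>2)"
    using A \<open>0 \<le> c\<close> by (intro mult_mono c) (auto simp: positive_op_iff)
  finally have "(norm ?y)\<^sup>2 * (norm ?y)\<^sup>2 \<le> (norm ?y)\<^sup>2 * (c * norm x)\<^sup>2"
    by (simp add: power2_eq_square mult_ac)
  then have "norm ?y = 0 \<or> (norm ?y)\<^sup>2 \<le> (c * norm x)\<^sup>2"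
    by (metis mult_le_cancel_left_pos zero_less_norm_iff zero_less_power norm_eq_zero)
  then show "norm ?y \<le> c * norm x"
    using \<open>0 \<le> c\<close> by (auto intro: power2_le_imp_le)
qed


section \<open>Positive square roots\<close>

text \<open>With \<open>D = I - A\<close> and \<open>B = I - R\<close> the equation \<open>R\<^sup>2 = A\<close> becomes \<open>B = (D + B\<^sup>2) / 2\<close>, which is
  solved by iteration from 0.  The scalar iteration, with \<open>D\<close> replaced by 1, dominates the
  increments in norm, which gives convergence as soon as \<open>\<parallel>D\<parallel> \<le> 1\<close>.\<close>

primrec sqrt_iter :: "'h::chilbert_space op \<Rightarrow> nat \<Rightarrow> 'h op" where
  "sqrt_iter D 0 = 0"
| "sqrt_iter D (Suc n) = (1/2) *\<^sub>R (D + (sqrt_iter D n o\<^sub>L sqrt_iter D n))"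

text \<open>The dominating scalar iteration; it increases and is bounded by 1.\<close>

primrec scalar_sqrt_iter :: "nat \<Rightarrow> real" where
  "scalar_sqrt_iter 0 = 0"
| "scalar_sqrt_iter (Suc n) = (1 + (scalar_sqrt_iter n)\<^sup>2) / 2"

lemma scalar_sqrt_iter_bounds: "0 \<le> scalar_sqrt_iter n \<and> scalar_sqrt_iter n \<le> 1"
  by (induction n) (auto simp: power_le_one add_nonneg_nonneg)

lemma scalar_sqrt_iter_convergent: "convergent scalar_sqrt_iter"
proof (rule Bseq_mono_convergent)
  show "Bseq scalar_sqrt_iter"
    using scalar_sqrt_iter_bounds by (intro BseqI'[of _ 1]) simp
  have "scalar_sqrt_iter n \<le> scalar_sqrt_iter (Suc n)" for n
    using zero_le_power2[of "1 - scalar_sqrt_iter n"] by (simp add: power2_diff)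
  then show "\<forall>m n. m \<le> n \<longrightarrow> scalar_sqrt_iter m \<le> scalar_sqrt_iter n"
    by (simp add: lift_Suc_mono_le)
qed

lemma sqrt_iter_norm_le:
  assumes "norm D \<le> 1"
  shows "norm (sqrt_iter D n) \<le> scalar_sqrt_iter n"
proof (induction n)
  case (Suc n)
  have "norm (sqrt_iter D n o\<^sub>L sqrt_iter D n) \<le> norm (sqrt_iter D n) * norm (sqrt_iter D n)"
    by (rule norm_blinfun_compose)
  also have "\<dots> \<le> (scalar_sqrt_iter n)\<^sup>2"
    unfolding power2_eq_square using Suc by (intro mult_mono) (auto simp: scalar_sqrt_iter_bounds)
  finally show ?case
    using norm_triangle_ineq[of D "sqrt_iter D n o\<^sub>L sqrt_iter D n"] assms by simp
qed simp

lemma sqrt_iter_increment_le: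
  assumes D: "norm D \<le> 1"
  shows "norm (sqrt_iter D (Suc n) - sqrt_iter D n) \<le> scalar_sqrt_iter (Suc n) - scalar_sqrt_iter n"
proof (induction n)
  case 0
  then show ?case using D by simp
next
  case (Suc n)
  define a b where "a = sqrt_iter D (Suc n)" and "b = sqrt_iter D n"
  define s t where "s = scalar_sqrt_iter (Suc n)" and "t = scalar_sqrt_iter n"
  have bounds: "norm a \<le> s" "norm b \<le> t" "norm (a - b) \<le> s - t" "0 \<le> s" "0 \<le> t"
    using sqrt_iter_norm_le[OF D] Suc scalar_sqrt_iter_bounds
    unfolding a_def b_def s_def t_def by blast+
  \<comment> \<open>This splitting of the difference of squares does not need \<open>a\<close> and \<open>b\<close> to commute.\<close>
  have "(a o\<^sub>L a) - (b o\<^sub>L b) = (a o\<^sub>L (a - b)) + ((a - b) o\<^sub>L b)"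
    by (rule blinfun_eqI) (simp add: blinfun.bilinear_simps)
  then have "norm ((a o\<^sub>L a) - (b o\<^sub>L b)) \<le> norm a * norm (a - b) + norm (a - b) * norm b"
    using norm_triangle_ineq[of "a o\<^sub>L (a - b)" "(a - b) o\<^sub>L b"]
      norm_blinfun_compose[of a "a - b"] norm_blinfun_compose[of "a - b" b] by simp
  also have "\<dots> \<le> s * (s - t) + (s - t) * t"
    using bounds norm_ge_zero[of "a - b"] norm_ge_zero[of b] by (intro add_mono mult_mono) linarith+
  finally have "norm ((a o\<^sub>L a) - (b o\<^sub>L b)) \<le> s\<^sup>2 - t\<^sup>2"
    by (simp add: algebra_simps power2_eq_square)
  moreover have "sqrt_iter D (Suc (Suc n)) - a = (1/2) *\<^sub>R ((a o\<^sub>L a) - (b o\<^sub>L b))"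
    by (simp add: a_def[symmetric] b_def[symmetric]) (simp add: a_def b_def algebra_simps)
  moreover have "scalar_sqrt_iter (Suc (Suc n)) - s = (s\<^sup>2 - t\<^sup>2) / 2"
    by (simp add: s_def t_def field_simps)
  ultimately show ?case unfolding a_def[symmetric] s_def[symmetric] by simp
qed

lemma sqrt_iter_convergent:
  assumes D: "norm D \<le> 1"
  shows "convergent (sqrt_iter D)"
proof -
  obtain l where "scalar_sqrt_iter \<longlonglongrightarrow> l"
    using scalar_sqrt_iter_convergent unfolding convergent_def by blast
  then have "summable (\<lambda>n. scalar_sqrt_iter (Suc n) - scalar_sqrt_iter n)"
    by (rule telescope_summable)
  then have "summable (\<lambda>n. sqrt_iter D (Suc n) - sqrt_iter D n)"
    by (rule summable_comparison_test'[where N = 0]) (rule sqrt_iter_increment_le[OF D])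
  then have "convergent (\<lambda>n. \<Sum>i<n. sqrt_iter D (Suc i) - sqrt_iter D i)"
    by (simp add: summable_iff_convergent)
  then show ?thesis by (simp only: sum_lessThan_telescope) (simp add: fun_eq_iff)
qed

lemma selfadjoint_sqrt_iter: "selfadjoint_op D \<Longrightarrow> selfadjoint_op (sqrt_iter D n)"
proof (induction n)
  case (Suc n)
  then have "selfadjoint_op (sqrt_iter D n o\<^sub>L sqrt_iter D n)"
    by (simp add: selfadjoint_op_compose_self)
  with Suc show ?case
    by (auto intro!: selfadjoint_op_scaleR selfadjoint_op_add)
qed simp

lemma sqrt_iter_commute:
  assumes "T o\<^sub>L D = D o\<^sub>L T"
  shows "T o\<^sub>L sqrt_iter D n = sqrt_iter D n o\<^sub>L T"
proof (induction n)
  case (Suc n)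
  have *: "blinfun_apply T (blinfun_apply B x) = blinfun_apply B (blinfun_apply T x)"
    if "T o\<^sub>L B = B o\<^sub>L T" for B x
    using arg_cong[OF that, of "\<lambda>C. blinfun_apply C x"] by simp
  show ?case
    by (rule blinfun_eqI) (simp add: blinfun.bilinear_simps *[OF assms] *[OF Suc])
qed (rule blinfun_eqI, simp)

lemma tendsto_blinfun_apply: "f \<longlonglongrightarrow> A \<Longrightarrow> (\<lambda>n. blinfun_apply (f n) x) \<longlonglongrightarrow> blinfun_apply A x"
  by (intro tendsto_intros)

lemma selfadjoint_op_limit:
  assumes "f \<longlonglongrightarrow> A" "\<And>n. selfadjoint_op (f n)"
  shows "selfadjoint_op A"
  unfolding selfadjoint_op_def clinear_op_def
proof (intro conjI allI)
  note lim = tendsto_blinfun_apply[OF assms(1)]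
  note cinner = bounded_bilinear.tendsto[OF bounded_bilinear_cinner]
  show "blinfun_apply A (c *\<^sub>C x) = c *\<^sub>C blinfun_apply A x" for c x
  proof (rule LIMSEQ_unique)
    show "(\<lambda>n. blinfun_apply (f n) (c *\<^sub>C x)) \<longlonglongrightarrow> blinfun_apply A (c *\<^sub>C x)" by (rule lim)
    show "(\<lambda>n. blinfun_apply (f n) (c *\<^sub>C x)) \<longlonglongrightarrow> c *\<^sub>C blinfun_apply A x"
      using bounded_linear.tendsto[OF bounded_linear_scaleC lim, of c x] assms(2)
      by (simp add: selfadjoint_op_def clinear_op_def)
  qed
  show "cinner (blinfun_apply A x) y = cinner x (blinfun_apply A y)" for x y
  proof (rule LIMSEQ_unique)
    show "(\<lambda>n. cinner (blinfun_apply (f n) x) y) \<longlonglongrightarrow> cinner (blinfun_apply A x) y"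
      by (rule cinner[OF lim tendsto_const])
    show "(\<lambda>n. cinner (blinfun_apply (f n) x) y) \<longlonglongrightarrow> cinner x (blinfun_apply A y)"
      using cinner[OF tendsto_const lim, of x y] assms(2) by (simp add: selfadjoint_op_def)
  qed
qed

lemma contraction_sqrt_exists:
  assumes A: "positive_op A" and le: "\<And>x. Re (cinner x (blinfun_apply A x)) \<le> (norm x)\<^sup>2"
  shows "\<exists>B. positive_op B \<and> B o\<^sub>L B = A \<and> (\<forall>T. T o\<^sub>L A = A o\<^sub>L T \<longrightarrow> T o\<^sub>L B = B o\<^sub>L T)"
proof -
  define D where "D = id_blinfun - A"
  have saD: "selfadjoint_op D"
    unfolding D_def using A by (intro selfadjoint_op_diff) (auto simp: positive_op_iff)
  then have "positive_op D"
    using le by (simp add: positive_op_iff D_def blinfun.diff_left cinner_simps Re_cinner_self)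
  then have D1: "norm D \<le> 1"
    using A by (intro positive_op_norm_le)
      (simp_all add: positive_op_iff D_def blinfun.diff_left cinner_simps Re_cinner_self)
  obtain B where B: "sqrt_iter D \<longlonglongrightarrow> B"
    using sqrt_iter_convergent[OF D1] unfolding convergent_def by blast
  have comp: "(\<lambda>n. f n o\<^sub>L g n) \<longlonglongrightarrow> (F o\<^sub>L G)" if "f \<longlonglongrightarrow> F" "g \<longlonglongrightarrow> G" for f g and F G :: "'a op"
    using bounded_bilinear.tendsto[OF bounded_bilinear_blinfun_compose that] .
  have "(\<lambda>n. sqrt_iter D (Suc n)) \<longlonglongrightarrow> (1/2) *\<^sub>R (D + (B o\<^sub>L B))"
    unfolding sqrt_iter.simps by (intro tendsto_intros comp B)
  then have fix_eq: "B = (1/2) *\<^sub>R (D + (B o\<^sub>L B))"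
    using LIMSEQ_Suc[OF B] LIMSEQ_unique by blast
  have saB: "selfadjoint_op B"
    using selfadjoint_op_limit[OF B] selfadjoint_sqrt_iter[OF saD] by blast
  have "norm (sqrt_iter D n) \<le> 1" for n
    using sqrt_iter_norm_le[OF D1, of n] scalar_sqrt_iter_bounds[of n] by simp
  then have normB: "norm B \<le> 1"
    using LIMSEQ_le_const2[OF tendsto_norm[OF B]] by blast
  define R where "R = id_blinfun - B"
  have "Re (cinner x (blinfun_apply B x)) \<le> (norm x)\<^sup>2" for x
  proof -
    have "Re (cinner x (blinfun_apply B x)) \<le> norm x * norm (blinfun_apply B x)"
      by (rule Re_cinner_le_norm)
    also have "\<dots> \<le> norm x * (1 * norm x)"
      by (intro mult_left_mono order_trans[OF norm_blinfun] mult_right_mono normB) simp_all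
    finally show ?thesis by (simp add: power2_eq_square)
  qed
  then have "positive_op R"
    unfolding R_def positive_op_iff using saB
    by (auto intro!: selfadjoint_op_diff simp: blinfun.diff_left cinner_simps Re_cinner_self)
  moreover have "R o\<^sub>L R = A"
  proof -
    have "B + B = D + (B o\<^sub>L B)"
      using arg_cong[OF fix_eq, of "\<lambda>C. C + C"] by (simp flip: scaleR_left.add)
    then have "blinfun_apply B x + blinfun_apply B x = blinfun_apply D x + blinfun_apply B (blinfun_apply B x)" for x
      by (metis blinfun.add_left blinfun_apply_blinfun_compose)
    then show ?thesis
      by (intro blinfun_eqI) (simp add: R_def D_def blinfun.bilinear_simps algebra_simps)
  qed
  moreover have "T o\<^sub>L R = R o\<^sub>L T" if T: "T o\<^sub>L A = A o\<^sub>L T" for T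
  proof -
    have "blinfun_apply T (blinfun_apply A x) = blinfun_apply A (blinfun_apply T x)" for x
      using arg_cong[OF T, of "\<lambda>C. blinfun_apply C x"] by simp
    then have "T o\<^sub>L D = D o\<^sub>L T"
      by (intro blinfun_eqI) (simp add: D_def blinfun.bilinear_simps)
    then have "T o\<^sub>L sqrt_iter D n = sqrt_iter D n o\<^sub>L T" for n by (rule sqrt_iter_commute)
    then have "T o\<^sub>L B = B o\<^sub>L T"
      using comp[OF tendsto_const B, of T] comp[OF B tendsto_const, of T] LIMSEQ_unique by auto
    then have "blinfun_apply T (blinfun_apply B x) = blinfun_apply B (blinfun_apply T x)" for x
      by (metis blinfun_apply_blinfun_compose)
    then show ?thesis
      by (intro blinfun_eqI) (simp add: R_def blinfun.bilinear_simps)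
  qed
  ultimately show ?thesis by blast
qed

lemma positive_op_scaleR: "positive_op A \<Longrightarrow> 0 \<le> r \<Longrightarrow> positive_op (r *\<^sub>R A)"
  by (simp add: positive_op_iff selfadjoint_op_scaleR blinfun.scaleR_left cinner_simps)

text \<open>The root commutes with everything that commutes with \<open>A\<close>; uniqueness rests on this.\<close>

lemma sqrt_exists:
  assumes A: "positive_op A"
  shows "\<exists>B. positive_op B \<and> B o\<^sub>L B = A \<and> (\<forall>T. T o\<^sub>L A = A o\<^sub>L T \<longrightarrow> T o\<^sub>L B = B o\<^sub>L T)"
proof -
  \<comment> \<open>Rescaling by \<open>c\<close> makes \<open>A\<close> a contraction; the summand 1 covers \<open>A = 0\<close>.\<close>
  define c where "c = norm A + 1"
  have c: "0 < c" by (simp add: c_def add_nonneg_pos)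
  define A' where "A' = (1 / c) *\<^sub>R A"
  have A': "positive_op A'" unfolding A'_def using c by (intro positive_op_scaleR A) simp
  have "Re (cinner x (blinfun_apply A' x)) \<le> (norm x)\<^sup>2" for x
  proof -
    have "Re (cinner x (blinfun_apply A x)) \<le> norm x * norm (blinfun_apply A x)"
      by (rule Re_cinner_le_norm)
    also have "\<dots> \<le> norm x * (c * norm x)"
      by (intro mult_left_mono order_trans[OF norm_blinfun] mult_right_mono) (simp_all add: c_def)
    finally show ?thesis using c
      by (simp add: A'_def blinfun.scaleR_left cinner_simps power2_eq_square field_simps)
  qed
  then obtain B where B: "positive_op B" "B o\<^sub>L B = A'"
      "\<And>T. T o\<^sub>L A' = A' o\<^sub>L T \<Longrightarrow> T o\<^sub>L B = B o\<^sub>L T"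
    using contraction_sqrt_exists[OF A'] by blast
  define R where "R = sqrt c *\<^sub>R B"
  have pos: "positive_op R" unfolding R_def using c B(1) by (intro positive_op_scaleR) simp_all
  have "R o\<^sub>L R = c *\<^sub>R (B o\<^sub>L B)"
    using c by (intro blinfun_eqI) (simp add: R_def blinfun.bilinear_simps)
  then have sq: "R o\<^sub>L R = A" using B(2) c by (simp add: A'_def)
  have "T o\<^sub>L R = R o\<^sub>L T" if "T o\<^sub>L A = A o\<^sub>L T" for T
  proof -
    have "T o\<^sub>L A' = A' o\<^sub>L T"
      using that unfolding A'_def
      by (simp add: bounded_bilinear.scaleR_left[OF bounded_bilinear_blinfun_compose]
        bounded_bilinear.scaleR_right[OF bounded_bilinear_blinfun_compose])
    from B(3)[OF this] show ?thesis
      by (simp add: R_def bounded_bilinear.scaleR_left[OF bounded_bilinear_blinfun_compose]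
        bounded_bilinear.scaleR_right[OF bounded_bilinear_blinfun_compose])
  qed
  with pos sq show ?thesis by blast
qed

text \<open>If \<open>B\<close> and \<open>C\<close> commute and \<open>B\<^sup>2 = C\<^sup>2\<close>, then \<open>\<langle>y, (B + C) y\<rangle> = \<langle>y, (B\<^sup>2 - C\<^sup>2) x\<rangle> = 0\<close> for
  \<open>y = (B - C) x\<close>; by positivity \<open>B y = C y = 0\<close>, and then \<open>\<parallel>y\<parallel>\<^sup>2 = \<langle>x, (B - C) y\<rangle> = 0\<close>.\<close>

lemma commuting_sqrt_unique:
  assumes B: "positive_op B" and C: "positive_op C"
    and sq: "B o\<^sub>L B = C o\<^sub>L C" and comm: "B o\<^sub>L C = C o\<^sub>L B"
  shows "B = C"
proof (rule blinfun_eqI)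
  fix x
  define y where "y = blinfun_apply B x - blinfun_apply C x"
  have sq': "blinfun_apply B (blinfun_apply B x) = blinfun_apply C (blinfun_apply C x)"
    using arg_cong[OF sq, of "\<lambda>T. blinfun_apply T x"] by simp
  have comm': "blinfun_apply B (blinfun_apply C x) = blinfun_apply C (blinfun_apply B x)"
    using arg_cong[OF comm, of "\<lambda>T. blinfun_apply T x"] by simp
  have "blinfun_apply B y + blinfun_apply C y = 0"
    by (simp add: y_def blinfun.diff_right sq' comm')
  then have "cinner y (blinfun_apply B y) + cinner y (blinfun_apply C y) = 0"
    by (simp flip: cinner_add_right)
  then have "Re (cinner y (blinfun_apply B y)) + Re (cinner y (blinfun_apply C y)) = 0"
    by (metis plus_complex.simps(1) zero_complex.simps(1))
  moreover have "0 \<le> Re (cinner y (blinfun_apply B y))" "0 \<le> Re (cinner y (blinfun_apply C y))"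
    using B C by (simp_all add: positive_op_iff)
  ultimately have "blinfun_apply B y = 0" "blinfun_apply C y = 0"
    using B C by (auto intro!: positive_op_form_zero)
  moreover have "cinner y y = cinner x (blinfun_apply B y) - cinner x (blinfun_apply C y)"
    using selfadjoint_opD[OF positive_op_selfadjoint[OF B], of x y]
      selfadjoint_opD[OF positive_op_selfadjoint[OF C], of x y]
    by (simp add: y_def cinner_diff_left)
  ultimately have "cinner y y = 0" by simp
  then show "blinfun_apply B x = blinfun_apply C x" by (simp add: y_def cinner_self)
qed

lemma sqrt_op_eqI:
  assumes B: "positive_op B" and sq: "B o\<^sub>L B = A"
  shows "sqrt_op A = B"
proof -
  have "positive_op A"
    unfolding positive_op_iff
  proof (intro conjI allI)
    have sa: "selfadjoint_op B" using B by (rule positive_op_selfadjoint)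
    then show "selfadjoint_op A"
      using selfadjoint_op_compose_self sq by blast
    show "0 \<le> Re (cinner x (blinfun_apply A x))" for x
      using selfadjoint_opD[OF sa, of x "blinfun_apply B x"]
      by (metis sq blinfun_apply_blinfun_compose Re_cinner_self zero_le_power2)
  qed
  then obtain S where S: "positive_op S" "S o\<^sub>L S = A" "\<And>T. T o\<^sub>L A = A o\<^sub>L T \<Longrightarrow> T o\<^sub>L S = S o\<^sub>L T"
    using sqrt_exists by blast
  have *: "C = S" if C: "positive_op C" "C o\<^sub>L C = A" for C
  proof (rule commuting_sqrt_unique[OF C(1) S(1)])
    show "C o\<^sub>L C = S o\<^sub>L S" by (simp only: C(2) S(2))
    show "C o\<^sub>L S = S o\<^sub>L C"
      by (rule S(3)) (simp flip: C(2) add: blinfun_compose_assoc)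
  qed
  show ?thesis
    unfolding sqrt_op_def using * B sq by (intro the_equality) auto
qed

lemma
  assumes "positive_op A"
  shows positive_sqrt_op: "positive_op (sqrt_op A)"
    and sqrt_op_square: "sqrt_op A o\<^sub>L sqrt_op A = A"
proof -
  obtain B where B: "positive_op B" "B o\<^sub>L B = A" using sqrt_exists[OF assms] by blast
  with sqrt_op_eqI[OF B] show "positive_op (sqrt_op A)" "sqrt_op A o\<^sub>L sqrt_op A = A" by simp_all
qed

lemma sqrt_op_id: "sqrt_op (id_blinfun :: 'h::chilbert_space op) = id_blinfun"
  by (rule sqrt_op_eqI) (auto simp: positive_op_iff Re_cinner_self intro: blinfun_eqI)

lemma selfadjoint_sqrt_op: "positive_op A \<Longrightarrow> selfadjoint_op (sqrt_op A)"
  by (intro positive_op_selfadjoint positive_sqrt_op)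

lemma norm_sqrt_op_square:
  assumes "positive_op A"
  shows "(norm (blinfun_apply (sqrt_op A) x))\<^sup>2 = Re (cinner x (blinfun_apply A x))"
proof -
  have "(norm (blinfun_apply (sqrt_op A) x))\<^sup>2
      = Re (cinner x (blinfun_apply (sqrt_op A o\<^sub>L sqrt_op A) x))"
    by (simp add: selfadjoint_opD[OF selfadjoint_sqrt_op[OF assms]] flip: Re_cinner_self)
  then show ?thesis by (simp add: sqrt_op_square[OF assms])
qed


section \<open>Operators between closed subspaces\<close>

lemma closed_csubspace_closure_range:
  assumes "clinear_op S"
  shows "closed_csubspace (closure (range (blinfun_apply S)))"
proof (rule closure_csubspace)
  show "subspace (range (blinfun_apply S))"
    unfolding subspace_def
    by (auto simp flip: blinfun.add_right blinfun.scaleR_right intro!: range_eqI[of _ _ 0])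
  show "c *\<^sub>C x \<in> range (blinfun_apply S)" if "x \<in> range (blinfun_apply S)" for c x
    using that by (auto simp flip: clinear_op_apply[OF assms])
qed

lemma cinner_closure_range_zero:
  assumes "\<And>h. cinner (blinfun_apply S h) y = 0" and "k \<in> closure (range (blinfun_apply S))"
  shows "cinner k y = 0"
proof -
  obtain f where f: "\<And>n. f n \<in> range (blinfun_apply S)" "f \<longlonglongrightarrow> k"
    using assms(2) unfolding closure_sequential by blast
  have "(\<lambda>n. cinner (f n) y) \<longlonglongrightarrow> cinner k y"
    by (rule bounded_bilinear.tendsto[OF bounded_bilinear_cinner f(2) tendsto_const])
  moreover have "cinner (f n) y = 0" for n using f(1)[of n] assms(1) by auto
  ultimately show ?thesis by (simp add: LIMSEQ_const_iff)
qed

text \<open>An operator is determined by its values on the range of \<open>S\<close> and on the orthogonal complement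
  of that range.\<close>

lemma operator_eqI_dense:
  fixes A B S :: "'h::chilbert_space op"
  assumes S: "clinear_op S"
    and range: "\<And>h. blinfun_apply A (blinfun_apply S h) = blinfun_apply B (blinfun_apply S h)"
    and orth: "\<And>x. (\<And>k. k \<in> closure (range (blinfun_apply S)) \<Longrightarrow> cinner k x = 0)
      \<Longrightarrow> blinfun_apply A x = blinfun_apply B x"
  shows "A = B"
proof (rule blinfun_eqI)
  fix x
  obtain p where p: "p \<in> closure (range (blinfun_apply S))"
      "\<And>k. k \<in> closure (range (blinfun_apply S)) \<Longrightarrow> cinner k (x - p) = 0"
    using orthogonal_decomposition[OF closed_csubspace_closure_range[OF S]] by blast
  obtain f where f: "\<And>n. f n \<in> range (blinfun_apply S)" "f \<longlonglongrightarrow> p"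
    using p(1) unfolding closure_sequential by blast
  have "blinfun_apply A (f n) = blinfun_apply B (f n)" for n using f(1)[of n] range by auto
  moreover have "(\<lambda>n. blinfun_apply T (f n)) \<longlonglongrightarrow> blinfun_apply T p" for T :: "'h op"
    by (intro tendsto_intros f)
  ultimately have "blinfun_apply A p = blinfun_apply B p"
    by (metis (no_types, lifting) LIMSEQ_unique ext)
  moreover have "blinfun_apply A (x - p) = blinfun_apply B (x - p)" by (rule orth) (rule p(2))
  ultimately show "blinfun_apply A x = blinfun_apply B x" by (simp add: blinfun.diff_right)
qed

lemma op_between_orth: "op_between K L A \<Longrightarrow> (\<And>k. k \<in> K \<Longrightarrow> cinner k x = 0) \<Longrightarrow> blinfun_apply A x = 0"
  by (simp add: op_between_def)

lemma op_between_clinear: "op_between K L A \<Longrightarrow> clinear_op A"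
  by (simp add: op_between_def)

lemma op_between_range: "op_between K L A \<Longrightarrow> blinfun_apply A x \<in> L"
  by (auto simp: op_between_def)

lemma op_between_compose: "op_between K L A \<Longrightarrow> op_between L M B \<Longrightarrow> op_between K M (B o\<^sub>L A)"
  by (auto simp: op_between_def clinear_op_compose)

text \<open>The form of an operator living on \<open>K\<close> only sees the component in \<open>K\<close>.\<close>

lemma op_between_form:
  assumes K: "closed_csubspace K" and A: "op_between K K A"
  obtains p where "p \<in> K" "norm p \<le> norm x"
    "cinner x (blinfun_apply A x) = cinner p (blinfun_apply A p)"
proof -
  obtain p where p: "p \<in> K" "\<And>k. k \<in> K \<Longrightarrow> cinner k (x - p) = 0"
    using orthogonal_decomposition[OF K] by blast
  have "blinfun_apply A (x - p) = 0" using op_between_orth[OF A] p(2) by blast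
  then have "blinfun_apply A x = blinfun_apply A p" by (simp add: blinfun.diff_right)
  moreover have "cinner (x - p) (blinfun_apply A p) = 0"
    using p(2)[OF op_between_range[OF A]] cinner_commute by (metis complex_cnj_zero)
  ultimately have "cinner x (blinfun_apply A x) = cinner p (blinfun_apply A p)"
    by (simp add: cinner_diff_left)
  moreover have "norm p \<le> norm x" by (rule norm_orthogonal_component_le[OF p(2)[OF p(1)]])
  ultimately show thesis using that p(1) by blast
qed

lemma op_between_positive:
  assumes K: "closed_csubspace K" and A: "op_between K K A" and "selfadjoint_op A"
    and pos: "\<And>x. x \<in> K \<Longrightarrow> 0 \<le> Re (cinner x (blinfun_apply A x))"
  shows "positive_op A"
  unfolding positive_op_iff
proof (intro conjI allI)
  fix x
  obtain p where "p \<in> K" "cinner x (blinfun_apply A x) = cinner p (blinfun_apply A p)"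
    using op_between_form[OF K A] by blast
  then show "0 \<le> Re (cinner x (blinfun_apply A x))" using pos by simp
qed fact

lemma op_between_norm_le:
  assumes K: "closed_csubspace K" and A: "op_between K K A" and "positive_op A" and "0 \<le> c"
    and le: "\<And>x. x \<in> K \<Longrightarrow> Re (cinner x (blinfun_apply A x)) \<le> c * (norm x)\<^sup>2"
  shows "norm A \<le> c"
proof (rule positive_op_norm_le)
  fix x
  obtain p where p: "p \<in> K" "norm p \<le> norm x"
      "cinner x (blinfun_apply A x) = cinner p (blinfun_apply A p)"
    using op_between_form[OF K A] by blast
  have "c * (norm p)\<^sup>2 \<le> c * (norm x)\<^sup>2" using p(2) \<open>0 \<le> c\<close> by (intro mult_left_mono power_mono) simp_all
  then show "Re (cinner x (blinfun_apply A x)) \<le> c * (norm x)\<^sup>2" using le[OF p(1)] p(3) by simp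
qed fact+

lemma nonneg_on_minus_id:
  assumes "selfadjoint_op A"
  shows "nonneg_on K (A - a *\<^sub>R id_blinfun)
    \<longleftrightarrow> (\<forall>x\<in>K. a * (norm x)\<^sup>2 \<le> Re (cinner x (blinfun_apply A x)))"
  by (subst nonneg_on_selfadjoint)
    (simp_all add: assms selfadjoint_op_diff selfadjoint_op_scaleR blinfun.diff_left
      blinfun.scaleR_left cinner_simps Re_cinner_self)

lemma nonneg_on_id_minus:
  assumes "selfadjoint_op A"
  shows "nonneg_on K (b *\<^sub>R id_blinfun - A)
    \<longleftrightarrow> (\<forall>x\<in>K. Re (cinner x (blinfun_apply A x)) \<le> b * (norm x)\<^sup>2)"
  by (subst nonneg_on_selfadjoint)
    (simp_all add: assms selfadjoint_op_diff selfadjoint_op_scaleR blinfun.diff_left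
      blinfun.scaleR_left cinner_simps Re_cinner_self)

lemma op_between_sqrt:
  assumes K: "closed_csubspace K" and A: "op_between K K A" and pos: "positive_op A"
  shows "op_between K K (sqrt_op A)"
proof -
  have sa: "selfadjoint_op (sqrt_op A)" using pos by (rule selfadjoint_sqrt_op)
  have zero: "blinfun_apply (sqrt_op A) x = 0" if "\<And>k. k \<in> K \<Longrightarrow> cinner k x = 0" for x
  proof -
    have "(norm (blinfun_apply (sqrt_op A) x))\<^sup>2 = 0"
      using norm_sqrt_op_square[OF pos, of x] op_between_orth[OF A that] by simp
    then show ?thesis by simp
  qed
  have "blinfun_apply (sqrt_op A) x \<in> K" for x
  proof (rule orthogonal_orthogonal[OF K])
    fix y assume "\<And>k. k \<in> K \<Longrightarrow> cinner k y = 0"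
    then show "cinner y (blinfun_apply (sqrt_op A) x) = 0"
      using zero[of y] selfadjoint_opD[OF sa, of y x] by simp
  qed
  then show ?thesis
    using zero sa unfolding op_between_def selfadjoint_op_def by blast
qed

text \<open>The square root of an operator that is bounded below on \<open>K\<close> is injective on \<open>K\<close>; being
  self-adjoint, it maps dense subsets of \<open>K\<close> to dense subsets of \<open>K\<close>.\<close>

lemma closure_range_sqrt_compose:
  assumes S: "clinear_op S" and K: "K = closure (range (blinfun_apply S))"
    and A: "op_between K K A" and pos: "positive_op A" and "0 < a"
    and low: "\<And>x. x \<in> K \<Longrightarrow> a * (norm x)\<^sup>2 \<le> Re (cinner x (blinfun_apply A x))"
  shows "closure (range (blinfun_apply (sqrt_op A o\<^sub>L S))) = K"
proof
  let ?Q = "sqrt_op A"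
  let ?K' = "closure (range (blinfun_apply (?Q o\<^sub>L S)))"
  have cK: "closed_csubspace K" unfolding K by (rule closed_csubspace_closure_range[OF S])
  then have "closed K" by (simp add: closed_csubspace_def)
  have Q: "op_between K K ?Q" by (rule op_between_sqrt[OF cK A pos])
  have sa: "selfadjoint_op ?Q" using pos by (rule selfadjoint_sqrt_op)
  show sub: "?K' \<subseteq> K"
    by (rule closure_minimal[OF _ \<open>closed K\<close>]) (auto intro: op_between_range[OF Q])
  show "K \<subseteq> ?K'"
  proof
    fix x assume x: "x \<in> K"
    show "x \<in> ?K'"
    proof (rule orthogonal_orthogonal)
      show "closed_csubspace ?K'"
        by (intro closed_csubspace_closure_range clinear_op_compose S op_between_clinear[OF Q])
      fix y assume y: "\<And>k. k \<in> ?K' \<Longrightarrow> cinner k y = 0"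
      obtain p where p: "p \<in> K" "\<And>k. k \<in> K \<Longrightarrow> cinner k (y - p) = 0"
        using orthogonal_decomposition[OF cK] by blast
      have "cinner (blinfun_apply S h) (blinfun_apply ?Q p) = 0" for h
      proof -
        have mem: "blinfun_apply ?Q (blinfun_apply S h) \<in> ?K'"
          by (intro closure_subset[THEN subsetD]) (simp add: range_eqI)
        have "cinner (blinfun_apply ?Q (blinfun_apply S h)) p = 0"
          using y[OF mem] p(2)[of "blinfun_apply ?Q (blinfun_apply S h)"] mem sub
          by (auto simp: cinner_diff_right)
        then show ?thesis by (simp add: selfadjoint_opD[OF sa])
      qed
      then have "cinner k (blinfun_apply ?Q p) = 0" if "k \<in> K" for k
        using that cinner_closure_range_zero unfolding K by blast
      from this[OF op_between_range[OF Q, of p]] have "norm (blinfun_apply ?Q p) = 0"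
        by (simp add: cinner_self)
      then have "a * (norm p)\<^sup>2 \<le> 0"
        using low[OF p(1)] norm_sqrt_op_square[OF pos, of p] by simp
      then have "p = 0" using \<open>0 < a\<close> by (simp add: mult_le_0_iff)
      then have "cinner x y = 0" using p(2)[OF x] by simp
      then show "cinner y x = 0" by (metis cinner_commute complex_cnj_zero)
    qed
  qed
qed


section \<open>Edge contractions\<close>

text \<open>A norm-nonincreasing assignment \<open>S h \<mapsto> T h\<close> extends by continuity to the closure of the range
  of \<open>S\<close>, and by zero to the orthogonal complement.\<close>

lemma contraction_extension:
  fixes S T :: "'h::chilbert_space op"
  assumes S: "clinear_op S" and T: "clinear_op T"
    and le: "\<And>h. norm (blinfun_apply T h) \<le> norm (blinfun_apply S h)"
    and L: "closed L" "\<And>h. blinfun_apply T h \<in> L"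
  obtains C where "op_between (closure (range (blinfun_apply S))) L C" "norm C \<le> 1"
    "\<And>h. blinfun_apply C (blinfun_apply S h) = blinfun_apply T h"
proof -
  define K where "K = closure (range (blinfun_apply S))"
  have K: "closed_csubspace K" unfolding K_def by (rule closed_csubspace_closure_range[OF S])
  \<comment> \<open>The graph: \<open>p\<close> is the projection of \<open>x\<close>, approximated by \<open>S (f n)\<close>, and \<open>z\<close> is the limit of
    \<open>T (f n)\<close>.\<close>
  define R where "R x z \<longleftrightarrow> (\<exists>f p. (\<lambda>n. blinfun_apply S (f n)) \<longlonglongrightarrow> p \<and>
    (\<lambda>n. blinfun_apply T (f n)) \<longlonglongrightarrow> z \<and> (\<forall>k\<in>K. cinner k (x - p) = 0))" for x z
  have RI: "R x z" if "(\<lambda>n. blinfun_apply S (f n)) \<longlonglongrightarrow> p" "(\<lambda>n. blinfun_apply T (f n)) \<longlonglongrightarrow> z"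
    "\<And>k. k \<in> K \<Longrightarrow> cinner k (x - p) = 0" for x z f p
    unfolding R_def using that by blast
  have 1: "\<exists>z. R x z" for x
  proof -
    obtain p where p: "p \<in> K" "\<And>k. k \<in> K \<Longrightarrow> cinner k (x - p) = 0"
      using orthogonal_decomposition[OF K] by blast
    obtain g where g: "\<And>n. g n \<in> range (blinfun_apply S)" "g \<longlonglongrightarrow> p"
      using p(1) unfolding K_def closure_sequential by blast
    have "\<forall>n. \<exists>h. g n = blinfun_apply S h" using g(1) by blast
    then obtain f where f: "\<And>n. g n = blinfun_apply S (f n)" by metis
    have geq: "g = (\<lambda>n. blinfun_apply S (f n))" by (rule ext) (rule f)
    have lim: "(\<lambda>n. blinfun_apply S (f n)) \<longlonglongrightarrow> p" using g(2) unfolding geq .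
    then have "Cauchy (\<lambda>n. blinfun_apply S (f n))" by (rule LIMSEQ_imp_Cauchy)
    moreover have "dist (blinfun_apply T u) (blinfun_apply T v) \<le> dist (blinfun_apply S u) (blinfun_apply S v)" for u v
      using le[of "u - v"] by (simp add: dist_norm blinfun.diff_right)
    ultimately have "Cauchy (\<lambda>n. blinfun_apply T (f n))"
      unfolding Cauchy_def by (meson le_less_trans)
    then obtain z where z: "(\<lambda>n. blinfun_apply T (f n)) \<longlonglongrightarrow> z"
      using Cauchy_convergent convergent_def by blast
    from RI[OF lim z p(2)] show ?thesis by blast
  qed
  have 2: "R (x + y) (u + v)" if xy: "R x u" "R y v" for x y u v
  proof -
    obtain f p where f: "(\<lambda>n. blinfun_apply S (f n)) \<longlonglongrightarrow> p" "(\<lambda>n. blinfun_apply T (f n)) \<longlonglongrightarrow> u"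
        "\<And>k. k \<in> K \<Longrightarrow> cinner k (x - p) = 0"
      using xy(1) unfolding R_def by blast
    obtain g q where g: "(\<lambda>n. blinfun_apply S (g n)) \<longlonglongrightarrow> q" "(\<lambda>n. blinfun_apply T (g n)) \<longlonglongrightarrow> v"
        "\<And>k. k \<in> K \<Longrightarrow> cinner k (y - q) = 0"
      using xy(2) unfolding R_def by blast
    show ?thesis
    proof (rule RI[of "\<lambda>n. f n + g n" "p + q"])
      show "cinner k (x + y - (p + q)) = 0" if "k \<in> K" for k
        using f(3)[OF that] g(3)[OF that] by (simp add: cinner_simps)
    qed (simp_all add: blinfun.add_right tendsto_add f g)
  qed
  have 3: "R (c *\<^sub>C x) (c *\<^sub>C u)" if xu: "R x u" for c x u
  proof -
    obtain f p where f: "(\<lambda>n. blinfun_apply S (f n)) \<longlonglongrightarrow> p" "(\<lambda>n. blinfun_apply T (f n)) \<longlonglongrightarrow> u"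
        "\<And>k. k \<in> K \<Longrightarrow> cinner k (x - p) = 0"
      using xu unfolding R_def by blast
    show ?thesis
    proof (rule RI[of "\<lambda>n. c *\<^sub>C f n" "c *\<^sub>C p"])
      show "cinner k (c *\<^sub>C x - c *\<^sub>C p) = 0" if "k \<in> K" for k
        using f(3)[OF that] by (simp add: cinner_simps)
    qed (simp_all add: clinear_op_apply[OF S] clinear_op_apply[OF T] f
        bounded_linear.tendsto[OF bounded_linear_scaleC])
  qed
  have 4: "norm u \<le> 1 * norm x" if xu: "R x u" for x u
  proof -
    obtain f p where f: "(\<lambda>n. blinfun_apply S (f n)) \<longlonglongrightarrow> p" "(\<lambda>n. blinfun_apply T (f n)) \<longlonglongrightarrow> u"
        "\<And>k. k \<in> K \<Longrightarrow> cinner k (x - p) = 0"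
      using xu unfolding R_def by blast
    have "p \<in> K"
      unfolding K_def closure_sequential using f(1)
      by (intro exI[of _ "\<lambda>n. blinfun_apply S (f n)"]) simp
    from norm_orthogonal_component_le[OF f(3)[OF this]] have "norm p \<le> norm x" .
    moreover have "norm u \<le> norm p"
      using LIMSEQ_le[OF tendsto_norm[OF f(2)] tendsto_norm[OF f(1)]] le by blast
    ultimately show ?thesis by simp
  qed
  have "\<exists>C. clinear_op C \<and> norm C \<le> 1 \<and> (\<forall>x u. R x u \<longleftrightarrow> u = blinfun_apply C x)"
    by (rule bounded_operator_of_relation) (fact 1 2 3 4 zero_le_one)+
  then obtain C where C: "clinear_op C" "norm C \<le> 1" "\<forall>x u. R x u \<longleftrightarrow> u = blinfun_apply C x"
    by (elim exE conjE)
  show thesis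
  proof (rule that)
    show "norm C \<le> 1" by (rule C)
    have "R (blinfun_apply S h) (blinfun_apply T h)" for h
      by (rule RI[OF tendsto_const tendsto_const]) simp
    then show "blinfun_apply C (blinfun_apply S h) = blinfun_apply T h" for h
      using C(3) by simp
    have "blinfun_apply C x \<in> L" for x
    proof -
      have "R x (blinfun_apply C x)" using C(3) by simp
      then obtain f where "(\<lambda>n. blinfun_apply T (f n)) \<longlonglongrightarrow> blinfun_apply C x"
        unfolding R_def by blast
      then show ?thesis by (rule closed_sequentially[OF L(1) L(2)])
    qed
    moreover have "blinfun_apply C x = 0" if "\<And>k. k \<in> K \<Longrightarrow> cinner k x = 0" for x
    proof -
      have "R x 0"
        by (rule RI[of "\<lambda>_. 0" 0]) (simp_all add: that)
      then show ?thesis using C(3) by simp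
    qed
    ultimately show "op_between (closure (range (blinfun_apply S))) L C"
      using C(1) unfolding op_between_def K_def by blast
  qed
qed

lemma
  fixes S :: "nat list \<Rightarrow> 'h::chilbert_space op"
  assumes lin: "clinear_op (S w)" "clinear_op (S (w @ [j]))"
    and K: "K w = closure (range (blinfun_apply (S w)))"
      "K (w @ [j]) = closure (range (blinfun_apply (S (w @ [j]))))"
    and le: "\<And>h. norm (blinfun_apply (S (w @ [j])) h) \<le> norm (blinfun_apply (S w) h)"
  shows op_between_edge_contraction: "op_between (K w) (K (w @ [j])) (edge_contraction K S w j)"
    and edge_contraction_apply:
      "blinfun_apply (edge_contraction K S w j) (blinfun_apply (S w) h) = blinfun_apply (S (w @ [j])) h"
proof -
  have "blinfun_apply (S (w @ [j])) h \<in> K (w @ [j])" for h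
    unfolding K by (intro closure_subset[THEN subsetD]) simp
  moreover have "closed (K (w @ [j]))" unfolding K by simp
  ultimately obtain C where C: "op_between (K w) (K (w @ [j])) C" "norm C \<le> 1"
      "\<And>h. blinfun_apply C (blinfun_apply (S w) h) = blinfun_apply (S (w @ [j])) h"
    using contraction_extension[OF lin le, of "K (w @ [j])"] unfolding K(1) by blast
  have "edge_contraction K S w j = C"
    unfolding edge_contraction_def
  proof (rule the_equality)
    fix C' assume C': "op_between (K w) (K (w @ [j])) C' \<and> norm C' \<le> 1 \<and>
      (\<forall>h. blinfun_apply C' (blinfun_apply (S w) h) = blinfun_apply (S (w @ [j])) h)"
    show "C' = C"
    proof (rule operator_eqI_dense[OF lin(1)])
      show "blinfun_apply C' x = blinfun_apply C x"
        if "\<And>k. k \<in> closure (range (blinfun_apply (S w))) \<Longrightarrow> cinner k x = 0" for x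
      proof -
        have "blinfun_apply C' x = 0" "blinfun_apply C x = 0"
          using op_between_orth C' C(1) that unfolding K(1) by blast+
        then show ?thesis by simp
      qed
    qed (use C C' in simp)
  qed (use C in blast)
  with C show "op_between (K w) (K (w @ [j])) (edge_contraction K S w j)"
    "blinfun_apply (edge_contraction K S w j) (blinfun_apply (S w) h) = blinfun_apply (S (w @ [j])) h"
    by simp_all
qed


section \<open>Cylinder values of POVMs\<close>

lemma cyl_in_sets: "cyl m w \<in> sets (Omega m)"
proof -
  have "{x \<in> space (Omega m). x i = a} \<in> sets (Omega m)" for i a
  proof -
    have "{x \<in> space (Omega m). x i = a} = (\<lambda>x. x i) -` ({a} \<inter> {..<m}) \<inter> space (Omega m)"
      by (auto simp: Omega_def space_PiM PiE_def Pi_def)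
    also have "\<dots> \<in> sets (Omega m)"
      unfolding Omega_def by (rule measurable_sets[OF measurable_component_singleton]) auto
    finally show ?thesis .
  qed
  then have "{x \<in> space (Omega m). \<forall>i\<in>{..<length w}. x i = w ! i} \<in> sets (Omega m)"
    by (rule sets.sets_Collect_finite_All) simp_all
  also have "{x \<in> space (Omega m). \<forall>i\<in>{..<length w}. x i = w ! i} = cyl m w"
    by (auto simp: cyl_def)
  finally show ?thesis .
qed

lemma cyl_append_subset: "cyl m (w @ [j]) \<subseteq> cyl m w"
  by (auto simp: cyl_def nth_append)

lemma povm_mono:
  assumes E: "povm m E" and AB: "A \<in> sets (Omega m)" "B \<in> sets (Omega m)" "A \<subseteq> B"
  shows "Re (cinner x (blinfun_apply (E A) x)) \<le> Re (cinner x (blinfun_apply (E B) x))"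
proof -
  have sums: "(\<lambda>n. Re (cinner x (blinfun_apply (E (F n)) x))) sums Re (cinner x (blinfun_apply (E (\<Union>n. F n)) x))"
    if "range F \<subseteq> sets (Omega m)" "disjoint_family F" for F :: "nat \<Rightarrow> (nat \<Rightarrow> nat) set"
    by (rule bounded_linear.sums[OF bounded_linear_Re]) (use E that in \<open>simp add: povm_def\<close>)
  have pos: "0 \<le> Re (cinner x (blinfun_apply (E F) x))" if "F \<in> sets (Omega m)" for F
    using E that unfolding povm_def positive_op_iff by blast
  \<comment> \<open>Countable additivity is applied to the partition of \<open>B\<close> into \<open>A\<close>, \<open>B - A\<close> and empty sets.\<close>
  define F where "F n = (if n = 0 then A else if n = 1 then B - A else {})" for n :: nat
  have F: "range F \<subseteq> sets (Omega m)" using AB by (auto simp: F_def)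
  have disj: "disjoint_family F" by (auto simp: disjoint_family_on_def F_def)
  have "(\<Union>n. F n) = A \<union> (B - A)"
    by (auto simp: F_def split: if_splits)
  then have Un: "(\<Union>n. F n) = B" using AB(3) by auto
  have "(\<Sum>n\<in>{0}. Re (cinner x (blinfun_apply (E (F n)) x)))
      \<le> (\<Sum>n. Re (cinner x (blinfun_apply (E (F n)) x)))"
    using F by (intro sum_le_suminf sums_summable[OF sums[OF F disj]] pos) auto
  also have "\<dots> = Re (cinner x (blinfun_apply (E B) x))"
    using sums_unique[OF sums[OF F disj]] Un by simp
  finally show ?thesis by (simp add: F_def)
qed

lemma positive_povm_cyl: "povm m E \<Longrightarrow> positive_op (E (cyl m w))"
  using cyl_in_sets unfolding povm_def by blast

text \<open>Both sides are definite descriptions with equivalent conditions, so no POVM with the prescribed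
  values has to exist.\<close>

lemma povm_with_cyl_cong:
  assumes "\<And>w. w \<in> lists {..<m} \<Longrightarrow> G w = G' w"
  shows "povm_with_cyl m G = povm_with_cyl m G'"
  unfolding povm_with_cyl_def using assms by (simp cong: ball_cong)

lemma selfadjoint_root_cyl: "povm m E \<Longrightarrow> selfadjoint_op (root_cyl m E w)"
  unfolding root_cyl_def by (intro selfadjoint_sqrt_op positive_povm_cyl)

lemma norm_root_cyl_append_le:
  assumes "povm m E"
  shows "norm (blinfun_apply (root_cyl m E (w @ [j])) h) \<le> norm (blinfun_apply (root_cyl m E w) h)"
proof (rule power2_le_imp_le)
  show "(norm (blinfun_apply (root_cyl m E (w @ [j])) h))\<^sup>2 \<le> (norm (blinfun_apply (root_cyl m E w) h))\<^sup>2"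
    using povm_mono[OF assms cyl_in_sets cyl_in_sets cyl_append_subset]
    by (simp add: root_cyl_def norm_sqrt_op_square positive_povm_cyl[OF assms])
qed simp


section \<open>Composition of range martingales\<close>

theorem proposition6p5:
  fixes m :: nat
    and E :: "(nat \<Rightarrow> nat) set \<Rightarrow> 'h::chilbert_space op"
    and X Y Z :: "nat list \<Rightarrow> 'h op"
  assumes "m \<ge> 2"
    and "povm m E"
    and "strictly_positive_normalized_range_martingale m E X"
    and "factor_range_martingale m E X Y"
    and "\<And>w. w \<in> lists {..<m} \<Longrightarrow> Z w = sqrt_op (X w) o\<^sub>L Y w o\<^sub>L sqrt_op (X w)"
  shows "strictly_positive_normalized_range_martingale m E Z \<and>
         factor_transform_povm m E X Y = transform_povm m E Z"
proof -
  note E = assms(2) and Z = assms(5)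
  define W where "W = lists {..<m}"
  define K where "K = range_space m E"
  define R where "R = root_cyl m E"
  define S where "S = factor_map m E X"
  define Q where "Q w = sqrt_op (X w)" for w
  define C where "C w j = edge_contraction K R w j" for w j
  define D where "D w j = edge_contraction K S w j" for w j
  have S: "S w = Q w o\<^sub>L R w" for w by (simp add: S_def Q_def R_def factor_map_def)
  have Z: "Z w = Q w o\<^sub>L Y w o\<^sub>L Q w" if "w \<in> W" for w
    using Z that by (simp add: Q_def W_def)
  have app: "w @ [j] \<in> W" if "w \<in> W" "j < m" for w j
    using that by (simp add: W_def)
  have Rsa: "selfadjoint_op (R w)" for w unfolding R_def by (rule selfadjoint_root_cyl[OF E])
  then have Rlin: "clinear_op (R w)" for w by (simp add: selfadjoint_op_def)
  have KR: "K w = closure (range (blinfun_apply (R w)))" for w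
    by (simp add: K_def R_def range_space_def)
  have cK: "closed_csubspace (K w)" for w
    unfolding KR by (rule closed_csubspace_closure_range[OF Rlin])

  have X: "op_between (K w) (K w) (X w)" "selfadjoint_op (X w)"
      "X w = (\<Sum>j<m. adj_op (C w j) o\<^sub>L X (w @ [j]) o\<^sub>L C w j)" if "w \<in> W" for w
    using assms(3) that
    unfolding strictly_positive_normalized_range_martingale_def bounded_range_martingale_def
      martingale_along_def W_def K_def R_def C_def by blast+
  have Y: "op_between (K w) (K w) (Y w)" "selfadjoint_op (Y w)"
      "Y w = (\<Sum>j<m. adj_op (D w j) o\<^sub>L Y (w @ [j]) o\<^sub>L D w j)" if "w \<in> W" for w
    using assms(4) that
    unfolding factor_range_martingale_def martingale_along_def W_def K_def S_def D_def by blast+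
  have one: "X [] = id_blinfun" "Y [] = id_blinfun"
    using assms(3,4)
    by (simp_all add: strictly_positive_normalized_range_martingale_def factor_range_martingale_def)
  have "strictly_positive_on m K X" "strictly_positive_on m K Y"
    using assms(3,4)
    by (simp_all add: strictly_positive_normalized_range_martingale_def factor_range_martingale_def K_def)
  then obtain a b a' b' where ab: "0 < a" "a \<le> b" "0 < a'" "a' \<le> b'"
    and "\<And>w. w \<in> W \<Longrightarrow> nonneg_on (K w) (X w - a *\<^sub>R id_blinfun) \<and> nonneg_on (K w) (b *\<^sub>R id_blinfun - X w)"
    and "\<And>w. w \<in> W \<Longrightarrow> nonneg_on (K w) (Y w - a' *\<^sub>R id_blinfun) \<and> nonneg_on (K w) (b' *\<^sub>R id_blinfun - Y w)"
    unfolding strictly_positive_on_def W_def by blast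
  then have Xb: "a * (norm x)\<^sup>2 \<le> Re (cinner x (blinfun_apply (X w) x))"
        "Re (cinner x (blinfun_apply (X w) x)) \<le> b * (norm x)\<^sup>2"
      and Yb: "a' * (norm x)\<^sup>2 \<le> Re (cinner x (blinfun_apply (Y w) x))"
        "Re (cinner x (blinfun_apply (Y w) x)) \<le> b' * (norm x)\<^sup>2"
      if "w \<in> W" "x \<in> K w" for w x
    using that X(2) Y(2) by (simp_all add: nonneg_on_minus_id nonneg_on_id_minus)
  have Xpos: "positive_op (X w)" if w: "w \<in> W" for w
  proof (rule op_between_positive[OF cK X(1)[OF w] X(2)[OF w]])
    fix x assume "x \<in> K w"
    from Xb(1)[OF w this] show "0 \<le> Re (cinner x (blinfun_apply (X w) x))"
      using \<open>0 < a\<close> by (meson order_trans mult_nonneg_nonneg less_imp_le zero_le_power2)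
  qed
  have Q: "op_between (K w) (K w) (Q w)" "selfadjoint_op (Q w)"
      "(norm (blinfun_apply (Q w) x))\<^sup>2 = Re (cinner x (blinfun_apply (X w) x))" if w: "w \<in> W" for w x
    unfolding Q_def using op_between_sqrt[OF cK X(1)[OF w] Xpos[OF w]]
      selfadjoint_sqrt_op[OF Xpos[OF w]] norm_sqrt_op_square[OF Xpos[OF w]] by blast+
  have Slin: "clinear_op (S w)" if "w \<in> W" for w
    unfolding S using Q(2)[OF that] Rlin by (simp add: clinear_op_compose selfadjoint_op_def)
  have KS: "K w = closure (range (blinfun_apply (S w)))" if w: "w \<in> W" for w
    using closure_range_sqrt_compose[OF Rlin KR X(1)[OF w] Xpos[OF w] ab(1) Xb(1)[OF w]]
    by (simp add: S Q_def)

  have Cop: "op_between (K w) (K (w @ [j])) (C w j)"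
    and CR: "blinfun_apply (C w j) (blinfun_apply (R w) h) = blinfun_apply (R (w @ [j])) h" for w j h
  proof -
    have le: "norm (blinfun_apply (R (w @ [j])) h) \<le> norm (blinfun_apply (R w) h)" for h
      unfolding R_def by (rule norm_root_cyl_append_le[OF E])
    show "op_between (K w) (K (w @ [j])) (C w j)"
      unfolding C_def by (rule op_between_edge_contraction[OF Rlin Rlin KR KR le])
    show "blinfun_apply (C w j) (blinfun_apply (R w) h) = blinfun_apply (R (w @ [j])) h"
      unfolding C_def by (rule edge_contraction_apply[OF Rlin Rlin KR KR le])
  qed
  have Clin: "clinear_op (C w j)" for w j using Cop op_between_clinear by blast

  \<comment> \<open>The \<open>j\<close>-th term of the martingale identity for \<open>X\<close> is dominated by the whole sum.\<close>
  have Sle: "norm (blinfun_apply (S (w @ [j])) h) \<le> norm (blinfun_apply (S w) h)"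
    if w: "w \<in> W" and j: "j < m" for w j h
  proof (rule power2_le_imp_le)
    have Re_sum: "Re (cinner u (\<Sum>j<m. f j)) = (\<Sum>j<m. Re (cinner u (f j)))" for u :: 'h and f
      by (induction m) (simp_all add: cinner_add_right)
    define v where "v = blinfun_apply (R w) h"
    have summand: "(norm (blinfun_apply (S (w @ [i])) h))\<^sup>2
        = Re (cinner v (blinfun_apply (adj_op (C w i) o\<^sub>L X (w @ [i]) o\<^sub>L C w i) v))" if "i < m" for i
      using Q(3)[OF app[OF w that]]
      by (simp add: S v_def CR cinner_adj_op[OF Clin, symmetric])
    have "(norm (blinfun_apply (S (w @ [j])) h))\<^sup>2 \<le> (\<Sum>i<m. (norm (blinfun_apply (S (w @ [i])) h))\<^sup>2)"
      using j by (intro member_le_sum) auto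
    also have "\<dots> = Re (cinner v (blinfun_apply (X w) v))"
      by (subst X(3)[OF w]) (simp add: summand blinfun.sum_left Re_sum)
    also have "\<dots> = (norm (blinfun_apply (S w) h))\<^sup>2"
      using Q(3)[OF w] by (simp add: S v_def)
    finally show "(norm (blinfun_apply (S (w @ [j])) h))\<^sup>2 \<le> (norm (blinfun_apply (S w) h))\<^sup>2" .
  qed simp
  have Dop: "op_between (K w) (K (w @ [j])) (D w j)"
    and DS: "blinfun_apply (D w j) (blinfun_apply (S w) h) = blinfun_apply (S (w @ [j])) h"
    if w: "w \<in> W" and j: "j < m" for w j h
    unfolding D_def
    by (intro op_between_edge_contraction edge_contraction_apply Slin KS Sle app w j)+

  \<comment> \<open>The explicit formula for the edge contractions of the transformed POVM, multiplied by \<open>Q w\<close> on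
    the right so that no inverse occurs.\<close>
  have intertwine: "D w j o\<^sub>L Q w = Q (w @ [j]) o\<^sub>L C w j" if w: "w \<in> W" and j: "j < m" for w j
  proof (rule operator_eqI_dense[OF Rlin])
    show "blinfun_apply (D w j o\<^sub>L Q w) (blinfun_apply (R w) h)
        = blinfun_apply (Q (w @ [j]) o\<^sub>L C w j) (blinfun_apply (R w) h)" for h
      using DS[OF w j, of h] by (simp add: S CR)
    fix x assume "\<And>k. k \<in> closure (range (blinfun_apply (R w))) \<Longrightarrow> cinner k x = 0"
    then have x: "\<And>k. k \<in> K w \<Longrightarrow> cinner k x = 0" by (simp add: KR)
    show "blinfun_apply (D w j o\<^sub>L Q w) x = blinfun_apply (Q (w @ [j]) o\<^sub>L C w j) x"
      using op_between_orth[OF Q(1)[OF w] x] op_between_orth[OF Cop x] by simp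
  qed
  have intertwine_adj: "Q w o\<^sub>L adj_op (D w j) = adj_op (C w j) o\<^sub>L Q (w @ [j])"
    if w: "w \<in> W" and j: "j < m" for w j
  proof -
    have "adj_op (D w j o\<^sub>L Q w) = adj_op (Q (w @ [j]) o\<^sub>L C w j)" by (simp add: intertwine w j)
    then show ?thesis
      using op_between_clinear[OF Dop[OF w j]] op_between_clinear[OF Q(1)[OF w]] Clin
        op_between_clinear[OF Q(1)[OF app[OF w j]]]
      by (simp add: adj_op_compose adj_op_selfadjoint Q(2) w app[OF w j])
  qed

  have Zop: "op_between (K w) (K w) (Z w)" if "w \<in> W" for w
    unfolding Z[OF that] by (intro op_between_compose[OF Q(1)] op_between_compose[OF _ Q(1)] Y(1) that
        op_between_compose[OF _ op_between_compose])
  have Zsa: "selfadjoint_op (Z w)" if "w \<in> W" for w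
    unfolding Z[OF that] by (intro selfadjoint_op_sandwich Q(2) Y(2) that)
  have Zsum: "Z w = (\<Sum>j<m. adj_op (C w j) o\<^sub>L Z (w @ [j]) o\<^sub>L C w j)" if w: "w \<in> W" for w
  proof -
    have "Z w = (\<Sum>j<m. Q w o\<^sub>L (adj_op (D w j) o\<^sub>L Y (w @ [j]) o\<^sub>L D w j) o\<^sub>L Q w)"
      unfolding Z[OF w] by (subst Y(3)[OF w])
        (simp add: bounded_bilinear.sum_left[OF bounded_bilinear_blinfun_compose]
          bounded_bilinear.sum_right[OF bounded_bilinear_blinfun_compose])
    also have "\<dots> = (\<Sum>j<m. adj_op (C w j) o\<^sub>L Z (w @ [j]) o\<^sub>L C w j)"
    proof (rule sum.cong[OF refl])
      fix j assume "j \<in> {..<m}"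
      then have j: "j < m" by simp
      have "Q w o\<^sub>L (adj_op (D w j) o\<^sub>L Y (w @ [j]) o\<^sub>L D w j) o\<^sub>L Q w
          = (Q w o\<^sub>L adj_op (D w j)) o\<^sub>L Y (w @ [j]) o\<^sub>L (D w j o\<^sub>L Q w)"
        by (simp add: blinfun_compose_assoc)
      also have "\<dots> = adj_op (C w j) o\<^sub>L Z (w @ [j]) o\<^sub>L C w j"
        unfolding intertwine[OF w j] intertwine_adj[OF w j] Z[OF app[OF w j]]
        by (simp add: blinfun_compose_assoc)
      finally show "Q w o\<^sub>L (adj_op (D w j) o\<^sub>L Y (w @ [j]) o\<^sub>L D w j) o\<^sub>L Q w
        = adj_op (C w j) o\<^sub>L Z (w @ [j]) o\<^sub>L C w j" .
    qed
    finally show ?thesis .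
  qed

  have Zb: "(a' * a) * (norm x)\<^sup>2 \<le> Re (cinner x (blinfun_apply (Z w) x))"
      "Re (cinner x (blinfun_apply (Z w) x)) \<le> (b' * b) * (norm x)\<^sup>2" if w: "w \<in> W" and x: "x \<in> K w" for w x
  proof -
    let ?y = "blinfun_apply (Q w) x"
    have y: "?y \<in> K w" by (rule op_between_range[OF Q(1)[OF w]])
    have eq: "Re (cinner x (blinfun_apply (Z w) x)) = Re (cinner ?y (blinfun_apply (Y w) ?y))"
      by (simp add: Z[OF w] selfadjoint_opD[OF Q(2)[OF w]])
    have "(a' * a) * (norm x)\<^sup>2 \<le> a' * (norm ?y)\<^sup>2"
      unfolding Q(3)[OF w] mult.assoc using ab by (intro mult_left_mono Xb w x) simp
    then show "(a' * a) * (norm x)\<^sup>2 \<le> Re (cinner x (blinfun_apply (Z w) x))"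
      using Yb(1)[OF w y] eq by simp
    have "b' * (norm ?y)\<^sup>2 \<le> (b' * b) * (norm x)\<^sup>2"
      unfolding Q(3)[OF w] mult.assoc using ab by (intro mult_left_mono Xb w x) simp
    then show "Re (cinner x (blinfun_apply (Z w) x)) \<le> (b' * b) * (norm x)\<^sup>2"
      using Yb(2)[OF w y] eq by simp
  qed
  have pos: "0 < a' * a" "a' * a \<le> b' * b" using ab by (auto intro: mult_mono)
  have Zpos: "positive_op (Z w)" if w: "w \<in> W" for w
  proof (rule op_between_positive[OF cK Zop[OF w] Zsa[OF w]])
    fix x assume "x \<in> K w"
    from Zb(1)[OF w this] show "0 \<le> Re (cinner x (blinfun_apply (Z w) x))"
      using pos(1) by (meson order_trans mult_nonneg_nonneg less_imp_le zero_le_power2)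
  qed
  have Znorm: "norm (Z w) \<le> b' * b" if "w \<in> W" for w
    using op_between_norm_le[OF cK Zop[OF that] Zpos[OF that] _ Zb(2)[OF that]] pos by simp
  have "bdd_above ((\<lambda>w. norm (Z w)) ` W)" using Znorm by (auto intro!: bdd_aboveI)
  moreover have "martingale_along m K R Z"
    using Zop Zsa Zsum unfolding martingale_along_def W_def C_def by blast
  moreover have "strictly_positive_on m K Z"
    unfolding strictly_positive_on_def
  proof (intro exI conjI ballI)
    show "0 < a' * a" "a' * a \<le> b' * b" by (fact pos)+
    fix w assume "w \<in> lists {..<m}"
    then have w: "w \<in> W" by (simp add: W_def)
    show "nonneg_on (K w) (Z w - (a' * a) *\<^sub>R id_blinfun)" "nonneg_on (K w) ((b' * b) *\<^sub>R id_blinfun - Z w)"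
      using Zb[OF w] by (simp_all add: nonneg_on_minus_id nonneg_on_id_minus Zsa[OF w])
  qed
  moreover have "Z [] = id_blinfun"
    using Z[of "[]"] by (auto simp: W_def Q_def one sqrt_op_id intro!: blinfun_eqI)
  moreover have "factor_transform_povm m E X Y = transform_povm m E Z"
    unfolding factor_transform_povm_def transform_povm_def
  proof (rule povm_with_cyl_cong)
    fix w assume "w \<in> lists {..<m}"
    then have w: "w \<in> W" by (simp add: W_def)
    have "adj_op (S w) = R w o\<^sub>L Q w"
      unfolding S using Q(2)[OF w] Rsa[of w]
      by (simp add: adj_op_compose adj_op_selfadjoint Rlin selfadjoint_op_def)
    then show "adj_op (factor_map m E X w) o\<^sub>L Y w o\<^sub>L factor_map m E X w
        = root_cyl m E w o\<^sub>L Z w o\<^sub>L root_cyl m E w"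
      using Z[OF w] S[of w] by (simp add: blinfun_compose_assoc flip: S_def R_def)
  qed
  ultimately show ?thesis
    by (simp add: strictly_positive_normalized_range_martingale_def bounded_range_martingale_def
        W_def K_def R_def)
qed

end
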